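(* Let $\mathcal{R}\le\mathcal{U}$ be ergodic discrete probability-measure-preserving equivalence relations on a standard Borel probability space $(X,\mu)$. Suppose $\mathcal{R}$ is normal in $\mathcal{U}$. Then $$\mathcal{U}/\mathcal{R}\cong N_{\mathcal{U}}(\mathcal{R})/[\mathcal{R}],\qquad\text{where}\qquad N_{\mathcal{U}}(\mathcal{R}):=\{g\in[\mathcal{U}]:\ g[\mathcal{R}]g^{-1}=[\mathcal{R}]\}.$$ Moreover, $N_{\mathcal{U}}(\mathcal{R})=[\mathcal{U}]\cap\operatorname{Aut}(\mathcal{R})$.
   Context: A Borel equivalence relation on $(X,\mu)$ is discrete if all its classes are countable (or finite); ergodic if every measurable union of classes has measure $0$ or $1$. With $\mu_L(S)=\int |\{y:(x,y)\in S\}|\,d\mu(x)$ and $\mu_R(S)=\int |\{x:(x,y)\in S\}|\,d\mu(y)$ for Borel subsets $S$ of the relation, it is probability-measure-preserving if $\mu_L=\mu_R$. $\mathcal{R}\le\mathcal{U}$ means $\mathcal{R}\subset\mathcal{U}$ up to a null set; relations agreeing a.e. are identified. $\operatorname{Aut}(X,\mu)$ is the group of measure-preserving automorphisms of $(X,\mu)$, modulo a.e. equality. $\operatorname{Aut}(\mathcal{R})$ is the subgroup of all $\phi\in\operatorname{Aut}(X,\mu)$ such that $(x,y)\in\mathcal{R}\Leftrightarrow(\phi(x),\phi(y))\in\mathcal{R}$ (up to null sets). The full group $[\mathcal{R}]$ is the normal subgroup of all $\phi\in\operatorname{Aut}(\mathcal{R})$ with $(x,\phi(x))\in\mathcal{R}$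 for a.e. $x$; $[\mathcal{U}]$ is defined likewise. A discrete Borel groupoid is a groupoid with a standard Borel structure, Borel structure maps, and countable source fibers. $\mathcal{U}$ is regarded as a groupoid with $(x,y)(y,z)=(x,z)$. $\mathcal{R}\le\mathcal{U}$ is normal if (up to null sets) there are a discrete Borel groupoid $\mathcal{G}$ and a Borel homomorphism $c:\mathcal{U}\to\mathcal{G}$ with $\mathcal{R}=\operatorname{Ker}(c)=\{(x,y)\in\mathcal{U}:c(x,y)\text{ is a unit}\}$ (equivalent to the definition of Feldman, Sutherland and Zimmer). When $\mathcal{R}$ is normal and ergodic, $\mathcal{U}/\mathcal{R}$ is the countable group $Q$, unique up to isomorphism, for which there is a Borel homomorphism $\theta:\mathcal{U}\to Q$ (so $\theta(x,y)\theta(y,z)=\theta(x,z)$) with $\operatorname{Ker}(\theta)=\mathcal{R}$ a.e. and such that for a.e. $x$ and every $h\in Q$ there is $y\in[x]_{\mathcal{U}}$ with $\theta(y,x)=h$. *)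

theory Defs
  imports "HOL-Probability.Probability" "HOL-Algebra.Coset"
begin

section \<open>Standard Borel spaces\<close>

definition standard_borel :: "'a measure \<Rightarrow> bool" where
  "standard_borel M \<longleftrightarrow>
     (\<exists>T. topspace T = space M \<and> completely_metrizable_space T \<and> second_countable T
        \<and> sets M = sigma_sets (space M) {V. openin T V})"

definition standard_borel_prob_space :: "'a measure \<Rightarrow> bool" where
  "standard_borel_prob_space M \<longleftrightarrow> standard_borel M \<and> prob_space M"

definition conull_sets :: "'a measure \<Rightarrow> 'a set set" where
  "conull_sets M = {X \<in> sets M. space M - X \<in> null_sets M}"


section \<open>Discrete measured equivalence relations\<close>

definition discrete_borel_equiv :: "'a measure \<Rightarrow> ('a \<times> 'a) set \<Rightarrow> bool" where
  "discrete_borel_equiv M R \<longleftrightarrow>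
     R \<in> sets (M \<Otimes>\<^sub>M M) \<and> equiv (space M) R \<and> (\<forall>x\<in>space M. countable (R `` {x}))"

definition ergodic_rel :: "'a measure \<Rightarrow> ('a \<times> 'a) set \<Rightarrow> bool" where
  "ergodic_rel M R \<longleftrightarrow>
     (\<forall>A\<in>sets M. R `` A \<subseteq> A \<longrightarrow> emeasure M A = 0 \<or> emeasure M A = 1)"

text \<open>For Borel sets with countable sections in a standard Borel space the integrands below are
  measurable (Lusin-Novikov), so these are honest integrals.\<close>

definition mu_L :: "'a measure \<Rightarrow> ('a \<times> 'a) set \<Rightarrow> ennreal" where
  "mu_L M S = (\<integral>\<^sup>+x. emeasure (count_space UNIV) {y. (x, y) \<in> S} \<partial>M)"

definition mu_R :: "'a measure \<Rightarrow> ('a \<times> 'a) set \<Rightarrow> ennreal" where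
  "mu_R M S = (\<integral>\<^sup>+y. emeasure (count_space UNIV) {x. (x, y) \<in> S} \<partial>M)"

definition pmp_rel :: "'a measure \<Rightarrow> ('a \<times> 'a) set \<Rightarrow> bool" where
  "pmp_rel M R \<longleftrightarrow> (\<forall>S\<in>sets (M \<Otimes>\<^sub>M M). S \<subseteq> R \<longrightarrow> mu_L M S = mu_R M S)"

definition ergodic_discrete_pmp :: "'a measure \<Rightarrow> ('a \<times> 'a) set \<Rightarrow> bool" where
  "ergodic_discrete_pmp M R \<longleftrightarrow>
     discrete_borel_equiv M R \<and> pmp_rel M R \<and> ergodic_rel M R"

text \<open>Inclusion and equality of relations up to null sets are taken to mean: after restriction to
  a conull subset of the space. For Borel subsets of a discrete measure-preserving equivalence
  relation this is the same as holding up to a null set for \<^const>\<open>mu_L\<close>, because the saturation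
  of a null set is null.\<close>

definition rel_ae_le :: "'a measure \<Rightarrow> ('a \<times> 'a) set \<Rightarrow> ('a \<times> 'a) set \<Rightarrow> bool" where
  "rel_ae_le M R S \<longleftrightarrow> (\<exists>X\<in>conull_sets M. R \<inter> X \<times> X \<subseteq> S \<inter> X \<times> X)"

definition rel_ae_eq :: "'a measure \<Rightarrow> ('a \<times> 'a) set \<Rightarrow> ('a \<times> 'a) set \<Rightarrow> bool" where
  "rel_ae_eq M R S \<longleftrightarrow> (\<exists>X\<in>conull_sets M. R \<inter> X \<times> X = S \<inter> X \<times> X)"


section \<open>The group of measure-preserving automorphisms and its subgroups\<close>

text \<open>Representatives are everywhere defined Borel automorphisms. This loses nothing: an
  isomorphism between conull sets restricts to an invariant conull Borel set, and extends from
  there by the identity. Values outside the space are irrelevant.\<close>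

definition mp_maps :: "'a measure \<Rightarrow> ('a \<Rightarrow> 'a) set" where
  "mp_maps M = {f \<in> M \<rightarrow>\<^sub>M M. bij_betw f (space M) (space M)
     \<and> the_inv_into (space M) f \<in> M \<rightarrow>\<^sub>M M \<and> distr M M f = M}"

definition ae_eq :: "'a measure \<Rightarrow> (('a \<Rightarrow> 'a) \<times> ('a \<Rightarrow> 'a)) set" where
  "ae_eq M = {(f, g). f \<in> mp_maps M \<and> g \<in> mp_maps M \<and> (AE x in M. f x = g x)}"

text \<open>Elements of the group are a.e.-equality classes; the product is composition.\<close>

definition Aut :: "'a measure \<Rightarrow> ('a \<Rightarrow> 'a) set monoid" where
  "Aut M = \<lparr>carrier = mp_maps M // ae_eq M,
            mult = (\<lambda>A B. \<Union>f\<in>A. \<Union>g\<in>B. ae_eq M `` {f \<circ> g}),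
            one = ae_eq M `` {id}\<rparr>"

definition Aut_rel :: "'a measure \<Rightarrow> ('a \<times> 'a) set \<Rightarrow> ('a \<Rightarrow> 'a) set set" where
  "Aut_rel M R = {A \<in> carrier (Aut M). \<exists>f\<in>A. rel_ae_eq M R {(x, y). (f x, f y) \<in> R}}"

definition full_group :: "'a measure \<Rightarrow> ('a \<times> 'a) set \<Rightarrow> ('a \<Rightarrow> 'a) set set" where
  "full_group M R = {A \<in> Aut_rel M R. \<exists>f\<in>A. AE x in M. (x, f x) \<in> R}"

definition full_normalizer ::
    "'a measure \<Rightarrow> ('a \<times> 'a) set \<Rightarrow> ('a \<times> 'a) set \<Rightarrow> ('a \<Rightarrow> 'a) set set" where
  "full_normalizer M U R = {g \<in> full_group M U.
     (g <#\<^bsub>Aut M\<^esub> full_group M R) #>\<^bsub>Aut M\<^esub> inv\<^bsub>Aut M\<^esub> g = full_group M R}"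

definition normalizer_quotient ::
    "'a measure \<Rightarrow> ('a \<times> 'a) set \<Rightarrow> ('a \<times> 'a) set \<Rightarrow> ('a \<Rightarrow> 'a) set set monoid" where
  "normalizer_quotient M U R = (Aut M)\<lparr>carrier := full_normalizer M U R\<rparr> Mod full_group M R"


section \<open>Discrete Borel groupoids and normal subrelations\<close>

text \<open>A groupoid is given by its set of arrows, units being identified with identity arrows. The
  product of \<open>g\<close> and \<open>h\<close> is meaningful when the source of \<open>g\<close> is the target of \<open>h\<close>. Only the
  underlying measurable space of \<open>arrows\<close> is relevant.\<close>

record 'g groupoid =
  arrows :: "'g measure"
  src :: "'g \<Rightarrow> 'g"
  tgt :: "'g \<Rightarrow> 'g"
  gmul :: "'g \<Rightarrow> 'g \<Rightarrow> 'g"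
  ginv :: "'g \<Rightarrow> 'g"

definition composable :: "'g groupoid \<Rightarrow> ('g \<times> 'g) set" where
  "composable G = {(g, h) \<in> space (arrows G) \<times> space (arrows G). src G g = tgt G h}"

definition units :: "'g groupoid \<Rightarrow> 'g set" where
  "units G = {u \<in> space (arrows G). src G u = u}"

locale discrete_borel_groupoid =
  fixes G :: "'g groupoid"
  assumes src_src: "g \<in> space (arrows G) \<Longrightarrow> src G (src G g) = src G g"
    and tgt_src: "g \<in> space (arrows G) \<Longrightarrow> tgt G (src G g) = src G g"
    and src_tgt: "g \<in> space (arrows G) \<Longrightarrow> src G (tgt G g) = tgt G g"
    and tgt_tgt: "g \<in> space (arrows G) \<Longrightarrow> tgt G (tgt G g) = tgt G g"
    and src_mul: "(g, h) \<in> composable G \<Longrightarrow> src G (gmul G g h) = src G h"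
    and tgt_mul: "(g, h) \<in> composable G \<Longrightarrow> tgt G (gmul G g h) = tgt G g"
    and mul_assoc: "(g, h) \<in> composable G \<Longrightarrow> (h, k) \<in> composable G \<Longrightarrow>
      gmul G (gmul G g h) k = gmul G g (gmul G h k)"
    and mul_src: "g \<in> space (arrows G) \<Longrightarrow> gmul G g (src G g) = g"
    and tgt_mul_id: "g \<in> space (arrows G) \<Longrightarrow> gmul G (tgt G g) g = g"
    and src_inv: "g \<in> space (arrows G) \<Longrightarrow> src G (ginv G g) = tgt G g"
    and tgt_inv: "g \<in> space (arrows G) \<Longrightarrow> tgt G (ginv G g) = src G g"
    and inv_mul: "g \<in> space (arrows G) \<Longrightarrow> gmul G (ginv G g) g = src G g"
    and mul_inv: "g \<in> space (arrows G) \<Longrightarrow> gmul G g (ginv G g) = tgt G g"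
    and standard: "standard_borel (arrows G)"
    and src_borel: "src G \<in> arrows G \<rightarrow>\<^sub>M arrows G"
    and tgt_borel: "tgt G \<in> arrows G \<rightarrow>\<^sub>M arrows G"
    and inv_borel: "ginv G \<in> arrows G \<rightarrow>\<^sub>M arrows G"
    and mul_borel: "(\<lambda>(g, h). gmul G g h) \<in>
      restrict_space (arrows G \<Otimes>\<^sub>M arrows G) (composable G) \<rightarrow>\<^sub>M arrows G"
    and countable_fibers: "u \<in> units G \<Longrightarrow> countable {g \<in> space (arrows G). src G g = u}"

definition borel_groupoid_hom ::
    "'a measure \<Rightarrow> ('a \<times> 'a) set \<Rightarrow> 'g groupoid \<Rightarrow> ('a \<times> 'a \<Rightarrow> 'g) \<Rightarrow> bool" where
  "borel_groupoid_hom M U G c \<longleftrightarrow>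
     c \<in> restrict_space (M \<Otimes>\<^sub>M M) U \<rightarrow>\<^sub>M arrows G
     \<and> (\<forall>x y z. (x, y) \<in> U \<longrightarrow> (y, z) \<in> U \<longrightarrow>
          (c (x, y), c (y, z)) \<in> composable G
          \<and> gmul G (c (x, y)) (c (y, z)) = c (x, z))"

text \<open>The type argument records where the arrows of the groupoid live, since one cannot quantify
  over types here. A theorem with this predicate as a hypothesis, stated for an arbitrary \<open>'g\<close>,
  covers all groupoids.\<close>

definition normal_subrel ::
    "'g itself \<Rightarrow> 'a measure \<Rightarrow> ('a \<times> 'a) set \<Rightarrow> ('a \<times> 'a) set \<Rightarrow> bool" where
  "normal_subrel (_ :: 'g itself) M R U \<longleftrightarrow>
     (\<exists>X\<in>conull_sets M. \<exists>(G :: 'g groupoid) c.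
        discrete_borel_groupoid G \<and> borel_groupoid_hom M (U \<inter> X \<times> X) G c
        \<and> R \<inter> X \<times> X = {p \<in> U \<inter> X \<times> X. c p \<in> units G})"


section \<open>The quotient group of an ergodic normal subrelation\<close>

text \<open>\<open>is_quotient M U R Q\<close> is the defining property of the group \<open>Q = U / R\<close>.\<close>

definition is_quotient ::
    "'a measure \<Rightarrow> ('a \<times> 'a) set \<Rightarrow> ('a \<times> 'a) set \<Rightarrow> 'q monoid \<Rightarrow> bool" where
  "is_quotient M U R Q \<longleftrightarrow>
     group Q \<and> countable (carrier Q)
     \<and> (\<exists>\<theta>. \<theta> \<in> restrict_space (M \<Otimes>\<^sub>M M) U \<rightarrow>\<^sub>M count_space (carrier Q)
          \<and> (\<forall>x y z. (x, y) \<in> U \<longrightarrow> (y, z) \<in> U \<longrightarrow>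
               \<theta> (x, y) \<otimes>\<^bsub>Q\<^esub> \<theta> (y, z) = \<theta> (x, z))
          \<and> rel_ae_eq M R {p \<in> U. \<theta> p = \<one>\<^bsub>Q\<^esub>}
          \<and> (AE x in M. \<forall>h\<in>carrier Q. \<exists>y. (y, x) \<in> U \<and> \<theta> (y, x) = h))"

end

theory Submission
  imports Defs
begin

text \<open>A Borel set with a non-null projection contains, up to a null set, the graph of a measurable
  map over its projection (Jankov-von Neumann). Inside a measure-preserving relation such a map can be
  made injective by uniformizing twice, and it then preserves the measure; by ergodicity a maximal
  partial isomorphism is defined almost everywhere. Hence the full group of \<open>R\<close> knows \<open>R\<close>: if \<open>f\<close>
  does not preserve \<open>R\<close>, some element of the full group moves points along bad pairs and is
  conjugated out of it, so the normalizer is \<open>[U] \<inter> Aut(R)\<close>. For \<open>f\<close> in the normalizer the function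
  \<open>\<lambda>x. \<theta> (f x, x)\<close> is \<open>R\<close>-invariant, so it is constant, and \<open>f \<mapsto> \<theta> (f x, x)\<close> is a homomorphism onto
  \<open>Q\<close> with kernel \<open>[R]\<close>. To obtain \<open>Q\<close> from a groupoid cocycle, ergodicity makes its unit map
  constant, so that the cocycle takes values in one countable isotropy group.\<close>

section \<open>Standard Borel spaces\<close>

text \<open>Sets are projected throughout, and projections of Borel sets need not be Borel.
  Selection is therefore only asked for almost everywhere, at the price of an exceptional null set
  at every turn. These are harmless because the saturation of a null set under a measure-preserving
  relation is null: every almost sure property holds on a conull Borel set that is a union of
  classes. On such a set cocycle identities hold pointwise, and a map defined only there extends by
  the identity. The order of arguments in \<open>\<theta> (f x, x)\<close> makes the assignment
  multiplicative and not antimultiplicative, since \<open>\<theta> (f (g x), g x)\<close> times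
  \<open>\<theta> (g x, x)\<close> is \<open>\<theta> (f (g x), x)\<close>. Ergodicity of the small
  relation enters twice: it makes this value constant, and it gives surjectivity, because after a
  step of value \<open>h\<close> one can still reach any non-null set inside the
  \<open>R\<close>-class without changing the value.\<close>

abbreviation baire_space :: "(nat \<Rightarrow> nat) measure" where
  "baire_space \<equiv> \<Pi>\<^sub>M i\<in>UNIV. count_space UNIV"

text \<open>Second countability and T1 reduce equality of points to countably many Borel tests. This
  yields measurable points and diagonals, and later the constancy of an invariant map with values in
  a standard Borel space.\<close>

lemma standard_borel_separating:
  assumes "standard_borel M"
  obtains B where "countable B" "B \<subseteq> sets M"
    "\<And>x y. x \<in> space M \<Longrightarrow> y \<in> space M \<Longrightarrow> x \<noteq> y \<Longrightarrow> \<exists>V\<in>B. x \<in> V \<and> y \<notin> V"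
proof -
  obtain T where T: "topspace T = space M" "completely_metrizable_space T" "second_countable T"
      "sets M = sigma_sets (space M) {V. openin T V}"
    using assms unfolding standard_borel_def by blast
  obtain B where B: "countable B" "\<And>V. V \<in> B \<Longrightarrow> openin T V"
      "\<And>U x. openin T U \<Longrightarrow> x \<in> U \<Longrightarrow> \<exists>V\<in>B. x \<in> V \<and> V \<subseteq> U"
    using T(3) unfolding second_countable_def by metis
  have "t1_space T"
    by (simp add: T(2) completely_metrizable_imp_metrizable_space metrizable_imp_t1_space)
  then have sep: "\<exists>U. openin T U \<and> x \<in> U \<and> y \<notin> U"
    if "x \<in> space M" "y \<in> space M" "x \<noteq> y" for x y
    using that unfolding t1_space_def T(1) by blast
  show thesis
  proof
    show "countable B" by (rule B(1))
    show "B \<subseteq> sets M" using B(2) unfolding T(4) by (auto intro: sigma_sets.Basic)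
    show "\<exists>V\<in>B. x \<in> V \<and> y \<notin> V" if "x \<in> space M" "y \<in> space M" "x \<noteq> y" for x y
      using sep[OF that] B(3) by blast
  qed
qed

lemma standard_borel_singleton:
  assumes "standard_borel M" and x: "x \<in> space M"
  shows "{x} \<in> sets M"
proof -
  obtain B where B: "countable B" "B \<subseteq> sets M"
    "\<And>x y. x \<in> space M \<Longrightarrow> y \<in> space M \<Longrightarrow> x \<noteq> y \<Longrightarrow> \<exists>V\<in>B. x \<in> V \<and> y \<notin> V"
    using standard_borel_separating[OF assms(1)] by blast
  have "{x} = space M - (\<Union>V\<in>{V\<in>B. x \<notin> V}. V) - (\<Union>V\<in>{V\<in>B. x \<in> V}. space M - V)"
    using B(3) x by blast
  also have "\<dots> \<in> sets M"
    using B(1,2) by (intro sets.Diff sets.top sets.countable_UN' countable_subset[OF _ B(1)]) auto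
  finally show ?thesis .
qed

text \<open>By separation, the complement of the diagonal is a countable union of measurable
  rectangles.\<close>

lemma standard_borel_diagonal:
  assumes "standard_borel M"
  shows "{(x, y). x \<in> space M \<and> x = y} \<in> sets (M \<Otimes>\<^sub>M M)"
proof -
  obtain B where B: "countable B" "B \<subseteq> sets M"
    "\<And>x y. x \<in> space M \<Longrightarrow> y \<in> space M \<Longrightarrow> x \<noteq> y \<Longrightarrow> \<exists>V\<in>B. x \<in> V \<and> y \<notin> V"
    using standard_borel_separating[OF assms] by blast
  have "{(x, y). x \<in> space M \<and> x = y} = space M \<times> space M - (\<Union>V\<in>B. V \<times> (space M - V))"
    (is "?D = ?E")
  proof (rule Set.set_eqI)
    fix p :: "'a \<times> 'a"
    obtain x y where p: "p = (x, y)" by (cases p)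
    have "V \<subseteq> space M" if "V \<in> B" for V using B(2) that sets.sets_into_space by blast
    then show "p \<in> ?D \<longleftrightarrow> p \<in> ?E" using B(3)[of x y] unfolding p by auto
  qed
  also have "\<dots> \<in> sets (M \<Otimes>\<^sub>M M)"
    using B(1,2) by (intro sets.Diff sets.countable_UN' pair_measureI) auto
  finally show ?thesis .
qed

text \<open>A point is coded by the indices of a rapidly converging sequence from a dense set; this is
  the only place where completeness enters.\<close>

lemma standard_borel_baire_coding:
  assumes "standard_borel M" and ne: "space M \<noteq> {}"
  obtains h where "h \<in> baire_space \<rightarrow>\<^sub>M M" "space M \<subseteq> range h"
proof -
  obtain T where T: "topspace T = space M" "completely_metrizable_space T" "second_countable T"
      "sets M = sigma_sets (space M) {V. openin T V}"
    using assms unfolding standard_borel_def by blast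
  obtain Y d where Yd: "Metric_space Y d" "Metric_space.mcomplete Y d"
    "T = Metric_space.mtopology Y d"
    using T(2) unfolding completely_metrizable_space_def by blast
  interpret Metric_space Y d by (rule Yd(1))
  have Y: "Y = space M" using T(1) Yd(3) by simp
  obtain B where B: "countable B" "\<And>V. V \<in> B \<Longrightarrow> openin T V"
      "\<And>U x. openin T U \<Longrightarrow> x \<in> U \<Longrightarrow> \<exists>V\<in>B. x \<in> V \<and> V \<subseteq> U"
    using T(3) unfolding second_countable_def by metis
  \<comment> \<open>One point from each nonempty basic open set gives a countable dense set.\<close>
  define C where "C = (\<lambda>V. SOME x. x \<in> V) ` (B - {{}})"
  have C: "countable C" "C \<subseteq> Y"
  proof -
    show "countable C" unfolding C_def using B(1) by auto
    show "C \<subseteq> Y" unfolding C_def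
    proof (rule image_subsetI)
      fix V assume V: "V \<in> B - {{}}"
      then have "(SOME x. x \<in> V) \<in> V" by (simp add: some_in_eq)
      moreover have "V \<subseteq> Y" using V B(2) openin_subset T(1) Y by fastforce
      ultimately show "(SOME x. x \<in> V) \<in> Y" by blast
    qed
  qed
  have dense: "\<exists>c\<in>C. d c x < e" if x: "x \<in> Y" and e: "e > 0" for x e
  proof -
    have "openin T (mball x e)" unfolding Yd(3) by simp
    then obtain V where V: "V \<in> B" "x \<in> V" "V \<subseteq> mball x e"
      using B(3) x e by (metis centre_in_mball_iff)
    then have "(SOME x. x \<in> V) \<in> V" by (meson someI)
    then have "d (SOME x. x \<in> V) x < e" using V(3) by (auto simp: commute)
    then show ?thesis using V unfolding C_def by blast
  qed
  have "C \<noteq> {}" using dense[of _ 1] ne Y by fastforce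
  define y where "y = from_nat_into C"
  have y: "y n \<in> Y" for n using C(2) \<open>C \<noteq> {}\<close> unfolding y_def by (metis from_nat_into subsetD)
  have y_dense: "\<exists>n. d (y n) x < e" if "x \<in> Y" "e > 0" for x e
    using dense[OF that] C(1) \<open>C \<noteq> {}\<close> unfolding y_def by (metis from_nat_into_surj)
  define r :: "nat \<Rightarrow> real" where "r n = inverse (of_nat (Suc n))" for n
  have r_pos: "r n > 0" for n by (simp add: r_def)
  have r_mono: "r n \<le> r m" if "m \<le> n" for m n using that by (simp add: r_def le_imp_inverse_le)
  have r_small: "\<exists>n. r n < e" if "e > 0" for e unfolding r_def by (rule reals_Archimedean[OF that])
  \<comment> \<open>The condition makes the coded points Cauchy, with limit within
    \<open>r m\<close> of the \<open>m\<close>-th one. It consists of countably many conditions on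
    two coordinates each, so \<open>D\<close> is measurable.\<close>
  define D where "D = {s. \<forall>m n. m \<le> n \<longrightarrow> d (y (s m)) (y (s n)) \<le> r m}"
  have lim_ex: "\<exists>x\<in>Y. \<forall>m. d (y (s m)) x \<le> r m" if s: "s \<in> D" for s
  proof -
    have "MCauchy (\<lambda>n. y (s n))" unfolding MCauchy_def
    proof (intro conjI allI impI)
      show "range (\<lambda>n. y (s n)) \<subseteq> Y" using y by auto
      fix e :: real assume "e > 0"
      then obtain N where N: "r N < e" using r_small by blast
      have "d (y (s n)) (y (s n')) < e" if "N \<le> n" "N \<le> n'" for n n'
      proof (cases "n \<le> n'")
        case True
        then show ?thesis using s N r_mono[OF that(1)] unfolding D_def by fastforce
      next
        case False
        then have "d (y (s n')) (y (s n)) \<le> r n'" using s unfolding D_def by auto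
        then show ?thesis using N r_mono[OF that(2)] by (simp add: commute)
      qed
      then show "\<exists>N. \<forall>n n'. N \<le> n \<longrightarrow> N \<le> n' \<longrightarrow> d (y (s n)) (y (s n')) < e" by blast
    qed
    then obtain x where "limitin mtopology (\<lambda>n. y (s n)) x sequentially"
      using Yd(2) unfolding mcomplete_def by blast
    then have x: "x \<in> Y" and lim: "\<And>e. e > 0 \<Longrightarrow> \<forall>\<^sub>F n in sequentially. d (y (s n)) x < e"
      unfolding limitin_metric by (auto elim: eventually_mono)
    have "d (y (s m)) x \<le> r m" for m
    proof (rule field_le_epsilon)
      fix e :: real assume "e > 0"
      from lim[OF this] obtain N where N: "\<And>n. n \<ge> N \<Longrightarrow> d (y (s n)) x < e"
        unfolding eventually_sequentially by blast
      define n where "n = max m N"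
      have "d (y (s m)) x \<le> d (y (s m)) (y (s n)) + d (y (s n)) x"
        using triangle y x by blast
      moreover have "d (y (s m)) (y (s n)) \<le> r m" using s unfolding D_def n_def by auto
      moreover have "d (y (s n)) x < e" using N unfolding n_def by auto
      ultimately show "d (y (s m)) x \<le> r m + e" by linarith
    qed
    then show ?thesis using x by blast
  qed
  obtain x0 where x0: "x0 \<in> Y" using ne Y by blast
  define h where "h s = (if s \<in> D then (SOME x. x \<in> Y \<and> (\<forall>m. d (y (s m)) x \<le> r m)) else x0)" for s
  have h: "h s \<in> Y" "s \<in> D \<Longrightarrow> d (y (s m)) (h s) \<le> r m" for s m
  proof -
    have *: "h s \<in> Y \<and> (\<forall>m. d (y (s m)) (h s) \<le> r m)" if "s \<in> D"
      using someI_ex[of "\<lambda>x. x \<in> Y \<and> (\<forall>m. d (y (s m)) x \<le> r m)"] lim_ex[OF that] that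
      unfolding h_def by auto
    then show "h s \<in> Y" using x0 unfolding h_def by (cases "s \<in> D") auto
    show "d (y (s m)) (h s) \<le> r m" if "s \<in> D" using *[OF that] by blast
  qed
  have D_sets [measurable]: "D \<in> sets baire_space"
  proof -
    have "D = {s \<in> space baire_space. \<forall>m n. m \<le> n \<longrightarrow> d (y (s m)) (y (s n)) \<le> r m}"
      unfolding D_def by (auto simp: space_PiM)
    also have "\<dots> \<in> sets baire_space"
      by measurable
    finally show ?thesis .
  qed
  \<comment> \<open>The limit lies in \<open>V\<close> iff some closed ball of radius
    \<open>r n\<close> about the \<open>n\<close>-th coded point is contained in \<open>V\<close>.
    That test reads only the coordinate \<open>s n\<close>, which makes the preimage
    measurable.\<close>
  have h_open: "h -` V \<inter> D = D \<inter> {s \<in> space baire_space. \<exists>n. mcball (y (s n)) (r n) \<subseteq> V}"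
    if V: "openin T V" for V
  proof (intro equalityI subsetI)
    fix s assume s: "s \<in> h -` V \<inter> D"
    then obtain e where e: "e > 0" "mball (h s) e \<subseteq> V"
      using V unfolding Yd(3) openin_mtopology by blast
    obtain n where n: "r n < e / 2" using r_small[of "e / 2"] e(1) half_gt_zero by blast
    have "mcball (y (s n)) (r n) \<subseteq> mball (h s) e"
    proof
      fix z assume z: "z \<in> mcball (y (s n)) (r n)"
      have "d (h s) z \<le> d (h s) (y (s n)) + d (y (s n)) z"
        using triangle h y z by auto
      also have "d (h s) (y (s n)) \<le> r n" using h(2)[of s n] s by (simp add: commute)
      also have "d (y (s n)) z \<le> r n" using z by auto
      finally show "z \<in> mball (h s) e" using n z h(1) by auto
    qed
    then show "s \<in> D \<inter> {s \<in> space baire_space. \<exists>n. mcball (y (s n)) (r n) \<subseteq> V}"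
      using s e(2) by (auto simp: space_PiM)
  next
    fix s assume "s \<in> D \<inter> {s \<in> space baire_space. \<exists>n. mcball (y (s n)) (r n) \<subseteq> V}"
    then obtain n where "s \<in> D" "mcball (y (s n)) (r n) \<subseteq> V" by auto
    moreover have "h s \<in> mcball (y (s n)) (r n)" using h y \<open>s \<in> D\<close> by auto
    ultimately show "s \<in> h -` V \<inter> D" by auto
  qed
  have "h \<in> baire_space \<rightarrow>\<^sub>M M"
  proof (rule measurable_sigma_sets[OF T(4)])
    show "{V. openin T V} \<subseteq> Pow (space M)" using T(1) openin_subset by fastforce
    show "h \<in> space baire_space \<rightarrow> space M" using h(1) Y by auto
    fix V assume "V \<in> {V. openin T V}"
    then have V: "openin T V" by simp
    have "h -` V \<inter> space baire_space = (h -` V \<inter> D) \<union> (if x0 \<in> V then space baire_space - D else {})"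
      by (auto simp: h_def space_PiM split: if_splits)
    also have "\<dots> \<in> sets baire_space"
    proof -
      define Q where "Q n k \<longleftrightarrow> mcball (y k) (r n) \<subseteq> V" for n k
      have "{s \<in> space baire_space. \<exists>n. Q n (s n)} \<in> sets baire_space"
        by measurable
      then have "h -` V \<inter> D \<in> sets baire_space"
        unfolding h_open[OF V] Q_def by (rule sets.Int[OF D_sets])
      then show ?thesis using D_sets by auto
    qed
    finally show "h -` V \<inter> space baire_space \<in> sets baire_space" .
  qed
  moreover have "space M \<subseteq> range h"
  proof
    fix x assume "x \<in> space M"
    then have x: "x \<in> Y" using Y by simp
    \<comment> \<open>With half the radius, the triangle inequality through \<open>x\<close> bounds
      the distance of two coded points by \<open>r m / 2 + r n / 2\<close>, at most
      \<open>r m\<close>, so the code lies in \<open>D\<close>.\<close>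
    have "\<forall>n. \<exists>k. d (y k) x < r n / 2" using y_dense[OF x] r_pos half_gt_zero by blast
    then obtain s where s: "\<And>n. d (y (s n)) x < r n / 2" by metis
    have "s \<in> D" unfolding D_def
    proof safe
      fix m n :: nat assume "m \<le> n"
      have "d (y (s m)) (y (s n)) \<le> d (y (s m)) x + d x (y (s n))"
        using triangle y x by blast
      then show "d (y (s m)) (y (s n)) \<le> r m"
        using s[of m] s[of n] r_mono[OF \<open>m \<le> n\<close>] by (simp add: commute)
    qed
    have "d x (h s) \<le> e" if "e > 0" for e
    proof -
      obtain n where n: "r n < e / 2" using r_small[of "e / 2"] \<open>e > 0\<close> half_gt_zero by blast
      have "d x (h s) \<le> d x (y (s n)) + d (y (s n)) (h s)"
        using triangle h y x by blast
      then show ?thesis using s[of n] h(2)[OF \<open>s \<in> D\<close>, of n] n r_pos[of n] commute[of x] by auto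
    qed
    then have "d x (h s) \<le> 0" by (metis field_le_epsilon add_0)
    then have "x = h s" using x h(1) by (metis mdist_pos_eq not_le)
    then show "x \<in> range h" by simp
  qed
  ultimately show thesis by (rule that)
qed

section \<open>Measurable selection\<close>

text \<open>Continuity into a discrete space: each value is decided by finitely many terms of both
  sequences, though not uniformly. For a fixed point \<open>x\<close> the condition
  \<open>x \<in> F s t\<close> is then clopen in \<open>s\<close> and \<open>t\<close>.\<close>

definition locally_const :: "((nat \<Rightarrow> nat) \<Rightarrow> (nat \<Rightarrow> nat) \<Rightarrow> 'b) \<Rightarrow> bool" where
  "locally_const F \<longleftrightarrow> (\<forall>s t. \<exists>m. \<forall>s' t'.
     (\<forall>i<m. s' i = s i \<and> t' i = t i) \<longrightarrow> F s' t' = F s t)"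

text \<open>Analytic subsets of the product with the Baire space: projections, along the second
  sequence, of sets that are closed in the two sequences and measurable in the point.\<close>

definition analytic_scheme ::
    "'a measure \<Rightarrow> ('a \<times> (nat \<Rightarrow> nat)) set \<Rightarrow> (nat \<Rightarrow> (nat \<Rightarrow> nat) \<Rightarrow> (nat \<Rightarrow> nat) \<Rightarrow> 'a set) \<Rightarrow> bool" where
  "analytic_scheme M S P \<longleftrightarrow> (\<forall>n. locally_const (P n)) \<and> (\<forall>n s t. P n s t \<in> sets M) \<and>
     S = {(x, s). x \<in> space M \<and> (\<exists>t. \<forall>n. x \<in> P n s t)}"

definition analytic_sets :: "'a measure \<Rightarrow> ('a \<times> (nat \<Rightarrow> nat)) set set" where
  "analytic_sets M = {S. \<exists>P. analytic_scheme M S P}"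

lemma analytic_setsI:
  assumes "\<And>n. locally_const (P n)" "\<And>n s t. P n s t \<in> sets M"
    and "S = {(x, s). x \<in> space M \<and> (\<exists>t. \<forall>n::nat. x \<in> P n s t)}"
  shows "S \<in> analytic_sets M"
  using assms unfolding analytic_sets_def analytic_scheme_def by blast

text \<open>Countably many witnesses are packed into one sequence by the pairing function; the
  condition with code \<open>(i, n)\<close> is the \<open>n\<close>-th condition of the
  \<open>i\<close>-th set.\<close>

lemma analytic_sets_INT:
  fixes S :: "nat \<Rightarrow> _"
  assumes "\<And>i. S i \<in> analytic_sets M"
  shows "(\<Inter>i. S i) \<in> analytic_sets M"
proof -
  obtain P where "\<And>i. analytic_scheme M (S i) (P i)"
    using assms unfolding analytic_sets_def mem_Collect_eq by metis
  then have P: "\<And>i n. locally_const (P i n)" "\<And>i n s t. P i n s t \<in> sets M"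
    and S: "\<And>i. S i = {(x, s). x \<in> space M \<and> (\<exists>t. \<forall>n::nat. x \<in> P i n s t)}"
    unfolding analytic_scheme_def by blast+
  define P' where "P' k s t =
    P (fst (prod_decode k)) (snd (prod_decode k)) s (\<lambda>j. t (prod_encode (fst (prod_decode k), j)))" for k s t
  show ?thesis
  proof (rule analytic_setsI)
    show "P' n s t \<in> sets M" for n s t unfolding P'_def by (rule P(2))
    show "locally_const (P' k)" for k
      unfolding locally_const_def
    proof (intro allI)
      fix s t :: "nat \<Rightarrow> nat"
      let ?i = "fst (prod_decode k)"
      obtain m where m: "\<And>s' t'. (\<forall>j<m. s' j = s j \<and> t' j = t (prod_encode (?i, j))) \<Longrightarrow>
          P ?i (snd (prod_decode k)) s' t' =
          P ?i (snd (prod_decode k)) s (\<lambda>j. t (prod_encode (?i, j)))"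
        using P(1)[of ?i "snd (prod_decode k)"] unfolding locally_const_def by meson
      \<comment> \<open>The sum bounds every code of a pair \<open>(?i, j)\<close> with
        \<open>j < m\<close>, so agreement below \<open>b\<close> fixes the first \<open>m\<close>
        terms of the relevant witness as well as those of \<open>s\<close>.\<close>
      define b where "b = Suc (m + (\<Sum>j<m. prod_encode (?i, j)))"
      have b: "j < b" "prod_encode (?i, j) < b" if "j < m" for j
        using that member_le_sum[of j "{..<m}" "\<lambda>j. prod_encode (?i, j)"] unfolding b_def by auto
      show "\<exists>m. \<forall>s' t'. (\<forall>i<m. s' i = s i \<and> t' i = t i) \<longrightarrow> P' k s' t' = P' k s t"
        unfolding P'_def using b by (intro exI[of _ b] allI impI m) auto
    qed
    show "(\<Inter>i. S i) = {(x, s). x \<in> space M \<and> (\<exists>t. \<forall>n. x \<in> P' n s t)}"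
    proof (intro equalityI subsetI)
      fix p assume p: "p \<in> (\<Inter>i. S i)"
      obtain x s where xs: "p = (x, s)" by (cases p)
      then have "x \<in> space M" and "\<forall>i. \<exists>t. \<forall>n. x \<in> P i n s t" using p S by auto
      then obtain t where t: "\<And>i n. x \<in> P i n s (t i)" by metis
      define t' where "t' k = t (fst (prod_decode k)) (snd (prod_decode k))" for k
      have "x \<in> P' k s t'" for k
        using t[of "fst (prod_decode k)" "snd (prod_decode k)"] unfolding P'_def t'_def by simp
      then show "p \<in> {(x, s). x \<in> space M \<and> (\<exists>t. \<forall>n. x \<in> P' n s t)}"
        using \<open>x \<in> space M\<close> xs by auto
    next
      fix p assume p: "p \<in> {(x, s). x \<in> space M \<and> (\<exists>t. \<forall>n. x \<in> P' n s t)}"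
      obtain x s where xs: "p = (x, s)" by (cases p)
      obtain t where x: "x \<in> space M" and t: "\<And>k. x \<in> P' k s t" using p xs by auto
      have "x \<in> P i n s (\<lambda>j. t (prod_encode (i, j)))" for i n
        using t[of "prod_encode (i, n)"] unfolding P'_def by simp
      then show "p \<in> (\<Inter>i. S i)" using x xs S by auto
    qed
  qed
qed

text \<open>The term \<open>t 0\<close> names a set that contains the point, and the remaining terms
  are the witness for it. An initial segment of length \<open>Suc m\<close> fixes the name and
  \<open>m\<close> terms of the witness.\<close>

lemma analytic_sets_UN:
  fixes S :: "nat \<Rightarrow> _"
  assumes "\<And>i. S i \<in> analytic_sets M"
  shows "(\<Union>i. S i) \<in> analytic_sets M"
proof -
  obtain P where "\<And>i. analytic_scheme M (S i) (P i)"
    using assms unfolding analytic_sets_def mem_Collect_eq by metis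
  then have P: "\<And>i n. locally_const (P i n)" "\<And>i n s t. P i n s t \<in> sets M"
    and S: "\<And>i. S i = {(x, s). x \<in> space M \<and> (\<exists>t. \<forall>n::nat. x \<in> P i n s t)}"
    unfolding analytic_scheme_def by blast+
  define P' where "P' n s t = P (t 0) n s (\<lambda>j. t (Suc j))" for n s and t :: "nat \<Rightarrow> nat"
  show ?thesis
  proof (rule analytic_setsI)
    show "P' n s t \<in> sets M" for n s t unfolding P'_def by (rule P(2))
    show "locally_const (P' n)" for n
      unfolding locally_const_def
    proof (intro allI)
      fix s t :: "nat \<Rightarrow> nat"
      obtain m where m: "\<And>s' t'. (\<forall>j<m. s' j = s j \<and> t' j = t (Suc j)) \<Longrightarrow>
          P (t 0) n s' t' = P (t 0) n s (\<lambda>j. t (Suc j))"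
        using P(1)[of "t 0" n] unfolding locally_const_def by meson
      show "\<exists>m. \<forall>s' t'. (\<forall>i<m. s' i = s i \<and> t' i = t i) \<longrightarrow> P' n s' t' = P' n s t"
      proof (intro exI[of _ "Suc m"] allI impI)
        fix s' t' assume *: "\<forall>i<Suc m. s' i = s i \<and> t' i = t i"
        then have "t' 0 = t 0" by simp
        then show "P' n s' t' = P' n s t" unfolding P'_def using * by (auto intro!: m)
      qed
    qed
    show "(\<Union>i. S i) = {(x, s). x \<in> space M \<and> (\<exists>t. \<forall>n. x \<in> P' n s t)}"
    proof (intro equalityI subsetI)
      fix p assume p: "p \<in> (\<Union>i. S i)"
      obtain x s where xs: "p = (x, s)" by (cases p)
      then obtain i t where "x \<in> space M" and t: "\<And>n. x \<in> P i n s t" using p S by auto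
      moreover have "x \<in> P' n s (case_nat i t)" for n using t unfolding P'_def by simp
      ultimately show "p \<in> {(x, s). x \<in> space M \<and> (\<exists>t. \<forall>n. x \<in> P' n s t)}"
        using xs by auto
    next
      fix p assume p: "p \<in> {(x, s). x \<in> space M \<and> (\<exists>t. \<forall>n. x \<in> P' n s t)}"
      obtain x s where xs: "p = (x, s)" by (cases p)
      obtain t where x: "x \<in> space M" and t: "\<And>k. x \<in> P' k s t" using p xs by auto
      have "(x, s) \<in> S (t 0)" using x t unfolding S P'_def by auto
      then show "p \<in> (\<Union>i. S i)" using xs by auto
    qed
  qed
qed

lemma analytic_sets_simple:
  assumes "locally_const F" "\<And>s t. F s t \<in> sets M" "\<And>s t t'. F s t = F s t'"
  shows "{(x, s). x \<in> space M \<and> x \<in> F s (\<lambda>_. 0)} \<in> analytic_sets M"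
proof (rule analytic_setsI[where P = "\<lambda>_. F"])
  show "{(x, s). x \<in> space M \<and> x \<in> F s (\<lambda>_. 0)} = {(x, s). x \<in> space M \<and> (\<exists>t. \<forall>n::nat. x \<in> F s t)}"
    using assms(3) by blast
qed (use assms in auto)

text \<open>Analytic sets need not be closed under complements. The sets that are analytic together
  with their complements do form a sigma-algebra, by the closure under countable unions and
  intersections, and it contains the generators of the product.\<close>

lemma borel_subset_analytic:
  assumes "S \<in> sets (M \<Otimes>\<^sub>M baire_space)"
  shows "S \<in> analytic_sets M"
proof -
  let ?X = "space M \<times> (UNIV :: (nat \<Rightarrow> nat) set)"
  define \<A> where "\<A> = {S. S \<subseteq> ?X \<and> S \<in> analytic_sets M \<and> ?X - S \<in> analytic_sets M}"
  \<comment> \<open>A family \<open>F\<close> indexed by the term \<open>s k\<close> covers both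
    kinds of generators: constant families give sets in the first factor, and families with values
    \<open>space M\<close> and \<open>{}\<close> give cylinders in the second.\<close>
  have base: "{(x, s). x \<in> space M \<and> x \<in> F (s k)} \<in> \<A>" if F: "\<And>j. F j \<in> sets M" for F :: "nat \<Rightarrow> _" and k
  proof -
    have *: "{(x, s). x \<in> space M \<and> x \<in> G (s k)} \<in> analytic_sets M" if G: "\<And>j. G j \<in> sets M" for G :: "nat \<Rightarrow> _"
    proof (rule analytic_sets_simple[of "\<lambda>s t. G (s k)"])
      show "locally_const (\<lambda>s t. G (s k))"
        unfolding locally_const_def by (intro allI exI[of _ "Suc k"]) auto
    qed (use G in auto)
    have "?X - {(x, s). x \<in> space M \<and> x \<in> F (s k)} = {(x, s). x \<in> space M \<and> x \<in> space M - F (s k)}"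
      by auto
    also have "\<dots> \<in> analytic_sets M" by (rule *) (use F in auto)
    finally show ?thesis using *[OF F] unfolding \<A>_def by auto
  qed
  interpret sigma_algebra ?X \<A>
    unfolding sigma_algebra_iff2
  proof (intro conjI ballI allI impI)
    show "\<A> \<subseteq> Pow ?X" unfolding \<A>_def by auto
    show "{} \<in> \<A>" using base[of "\<lambda>_. {}"] by simp
    show "?X - S \<in> \<A>" if "S \<in> \<A>" for S
    proof -
      have "?X - (?X - S) = S" using that unfolding \<A>_def by auto
      then show ?thesis using that unfolding \<A>_def by auto
    qed
    show "(\<Union>i::nat. A i) \<in> \<A>" if "range A \<subseteq> \<A>" for A
    proof -
      have A: "A i \<subseteq> ?X" "A i \<in> analytic_sets M" "?X - A i \<in> analytic_sets M" for i
        using that unfolding \<A>_def by auto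
      have "?X - (\<Union>i. A i) = (\<Inter>i. ?X - A i)" by auto
      also have "\<dots> \<in> analytic_sets M" by (rule analytic_sets_INT) (rule A)
      finally show ?thesis using A(1) analytic_sets_UN[of A M] A(2) unfolding \<A>_def by auto
    qed
  qed
  have sets: "sets (sigma ?X \<A>) = \<A>" and space: "space (sigma ?X \<A>) = ?X"
    by (simp_all)
  \<comment> \<open>Measurability of the identity amounts to the inclusion of the product
    sigma-algebra in \<open>\<A>\<close>.\<close>
  have "(\<lambda>p. p) \<in> sigma ?X \<A> \<rightarrow>\<^sub>M M \<Otimes>\<^sub>M baire_space"
  proof (rule measurable_pair)
    show "fst \<circ> (\<lambda>p. p) \<in> sigma ?X \<A> \<rightarrow>\<^sub>M M"
    proof (rule measurableI)
      fix A assume "A \<in> sets M"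
      then have "{(x, s). x \<in> space M \<and> x \<in> A} \<in> \<A>" using base[of "\<lambda>_. A"] by simp
      also have "{(x, s). x \<in> space M \<and> x \<in> A} = (fst \<circ> (\<lambda>p. p)) -` A \<inter> space (sigma ?X \<A>)"
        unfolding space by auto
      finally show "(fst \<circ> (\<lambda>p. p)) -` A \<inter> space (sigma ?X \<A>) \<in> sets (sigma ?X \<A>)" unfolding sets .
    qed (auto simp: space)
    show "snd \<circ> (\<lambda>p. p) \<in> sigma ?X \<A> \<rightarrow>\<^sub>M baire_space"
    proof (rule measurable_PiM_single)
      show "snd \<circ> (\<lambda>p. p) \<in> space (sigma ?X \<A>) \<rightarrow> (\<Pi>\<^sub>E i\<in>UNIV. space (count_space UNIV))" by auto
      fix A and k :: nat
      have "{(x, s). x \<in> space M \<and> x \<in> (if s k \<in> A then space M else {})} \<in> \<A>"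
        by (rule base) auto
      also have "{(x, s). x \<in> space M \<and> x \<in> (if s k \<in> A then space M else {})} =
         {\<omega> \<in> space (sigma ?X \<A>). (snd \<circ> (\<lambda>p. p)) \<omega> k \<in> A}"
        unfolding space by auto
      finally show "{\<omega> \<in> space (sigma ?X \<A>). (snd \<circ> (\<lambda>p. p)) \<omega> k \<in> A} \<in> sets (sigma ?X \<A>)"
        unfolding sets .
    qed
  qed
  from measurable_sets[OF this assms] have "S \<inter> ?X \<in> \<A>"
    unfolding sets space by simp
  moreover have "S \<subseteq> ?X" using sets.sets_into_space[OF assms] by (auto simp: space_pair_measure)
  ultimately show ?thesis unfolding \<A>_def by (simp add: Int_absorb2)
qed

text \<open>Replacing each Suslin set \<open>B l\<close> by its measurable envelope \<open>E l\<close> changes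
  \<open>B l = (\<Union>k. B (l @ [k]))\<close> only by a null set, and off these null sets the leftmost branch
  through the envelopes is a measurable selector.\<close>

lemma suslin_selection:
  fixes P :: "nat \<Rightarrow> (nat \<Rightarrow> nat) \<Rightarrow> 'a set"
  assumes P_sets: "\<And>n r. P n r \<in> sets M"
    and P_local: "\<And>n r. \<exists>m. \<forall>r'. (\<forall>i<m. r' i = r i) \<longrightarrow> P n r' = P n r"
    and "finite_measure M"
  obtains A f where "A \<in> sets M" "f \<in> M \<rightarrow>\<^sub>M baire_space" "\<And>x n. x \<in> A \<Longrightarrow> x \<in> P n (f x)"
    "AE x in M. (\<exists>r. \<forall>n. x \<in> P n r) \<longrightarrow> x \<in> A"
proof -
  interpret finite_measure M by fact
  define cyl where "cyl l = {r :: nat \<Rightarrow> nat. \<forall>i<length l. r i = l ! i}" for l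
  define B where "B l = {x \<in> space M. \<exists>r\<in>cyl l. \<forall>n. x \<in> P n r}" for l
  define H where "H l = (SOME E. measurable_envelope M (B l) E)" for l
  have H: "measurable_envelope M (B l) (H l)" for l
  proof -
    have "B l \<subseteq> space M" unfolding B_def by auto
    then obtain E where E: "E \<in> sets M" "B l \<subseteq> E" "outer_measure_of M (B l) = emeasure M E"
      using outer_measure_of_attain[of "B l" M] by auto
    then have "measurable_envelope M (B l) E"
      by (subst measurable_envelope_eq2) (auto simp: less_top[symmetric])
    then show ?thesis unfolding H_def by (rule someI)
  qed
  \<comment> \<open>The envelope alone would forget \<open>P\<close>, so each \<open>P n\<close>
    that is constant on the cylinder is intersected in. As \<open>P n r\<close> is decided by an
    initial segment of \<open>r\<close>, a point that stays in \<open>E\<close> along a branch lies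
    in every \<open>P n\<close> of that branch.\<close>
  define E where "E l = H l \<inter> (\<Inter>n. if \<exists>C. \<forall>r\<in>cyl l. P n r = C then P n ((!) l) else space M)" for l
  have cyl_nth: "(!) l \<in> cyl l" for l unfolding cyl_def by auto
  have E_sets [measurable]: "E l \<in> sets M" for l
    unfolding E_def using measurable_envelopeD(2)[OF H] P_sets by (intro sets.Int sets.countable_INT) auto
  have E_sub: "E l \<subseteq> P n r" if "r \<in> cyl l" "\<forall>r'\<in>cyl l. P n r' = P n r" for l n r
  proof -
    have "\<exists>C. \<forall>r\<in>cyl l. P n r = C" "P n ((!) l) = P n r" using that(2) cyl_nth by blast+
    then show ?thesis unfolding E_def by auto
  qed
  have B_E: "B l \<subseteq> E l" for l
  proof
    fix x assume x: "x \<in> B l"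
    then have "x \<in> H l" using measurable_envelopeD(1)[OF H] by auto
    moreover have "x \<in> P n ((!) l)" if "\<forall>r\<in>cyl l. P n r = C" for n C
      using x that cyl_nth unfolding B_def by blast
    ultimately show "x \<in> E l" using x unfolding E_def B_def by auto
  qed
  have B_split: "B l \<subseteq> (\<Union>k. B (l @ [k]))" for l
  proof
    fix x assume "x \<in> B l"
    then obtain r where r: "x \<in> space M" "r \<in> cyl l" "\<forall>n. x \<in> P n r" unfolding B_def by auto
    have "r \<in> cyl (l @ [r (length l)])"
      using r(2) unfolding cyl_def by (auto simp: nth_append less_Suc_eq)
    then show "x \<in> (\<Union>k. B (l @ [k]))" using r unfolding B_def by auto
  qed
  have null: "AE x in M. x \<in> E l \<longrightarrow> (\<exists>k. x \<in> E (l @ [k]))" for l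
  proof -
    \<comment> \<open>A measurable subset of \<open>H l - B l\<close> is null because
      \<open>H l\<close> is an envelope of \<open>B l\<close>. The difference is such a subset since
      the sets \<open>B (l @ [k])\<close>, and hence the larger \<open>E (l @ [k])\<close>, cover
      \<open>B l\<close>.\<close>
    have "emeasure M (E l - (\<Union>k. E (l @ [k]))) = 0"
    proof (rule measurable_envelopeD1[OF H])
      show "E l - (\<Union>k. E (l @ [k])) \<in> sets M" by measurable
      show "E l - (\<Union>k. E (l @ [k])) \<subseteq> H l - B l"
      proof -
        have "E l \<subseteq> H l" unfolding E_def by (rule Int_lower1)
        moreover have "B l \<subseteq> (\<Union>k. E (l @ [k]))" 
          by (rule order_trans[OF B_split UN_mono[OF subset_refl B_E]])
        ultimately show ?thesis by blast
      qed
    qed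
    then have "E l - (\<Union>k. E (l @ [k])) \<in> null_sets M" by (auto intro: null_setsI)
    then show ?thesis using sets.sets_into_space[OF E_sets] by (intro AE_I'[of "E l - (\<Union>k. E (l @ [k]))"]) auto
  qed
  define Z where "Z = {x \<in> space M. \<forall>l. x \<in> E l \<longrightarrow> (\<exists>k. x \<in> E (l @ [k]))}"
  have Z [measurable]: "Z \<in> sets M" unfolding Z_def by measurable
  define pre where "pre x = rec_nat [] (\<lambda>_ l. l @ [LEAST k. x \<in> E (l @ [k])])" for x
  have pre_0: "pre x 0 = []" and pre_Suc: "pre x (Suc n) = pre x n @ [LEAST k. x \<in> E (pre x n @ [k])]" for x n
    unfolding pre_def by auto
  \<comment> \<open>\<open>LEAST\<close> is unspecified where no child contains \<open>x\<close>,
    yet it is measurable everywhere; so \<open>f\<close> is total, and only its values on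
    \<open>E [] \<inter> Z\<close> matter.\<close>
  define f where "f x n = (LEAST k. x \<in> E (pre x n @ [k]))" for x n
  have pre_f: "pre x n = map (f x) [0..<n]" for x n
    by (induction n) (simp_all add: pre_0 pre_Suc f_def)
  have step [measurable]: "(\<lambda>x. LEAST k. x \<in> E (l @ [k])) \<in> M \<rightarrow>\<^sub>M count_space UNIV" for l
    by measurable
  have pre_meas: "(\<lambda>x. pre x n) \<in> M \<rightarrow>\<^sub>M count_space UNIV" for n
  proof (induction n)
    case 0
    then show ?case by (simp add: pre_0)
  next
    case (Suc n)
    have *: "(\<lambda>x. l @ [LEAST k. x \<in> E (l @ [k])]) \<in> M \<rightarrow>\<^sub>M count_space UNIV" for l
      using measurable_compose[OF step[of l], of "\<lambda>k. l @ [k]" "count_space UNIV"] by simp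
    show ?case unfolding pre_Suc by (rule measurable_compose_countable[OF * Suc])
  qed
  have f_meas: "f \<in> M \<rightarrow>\<^sub>M baire_space"
  proof -
    have "(\<lambda>x. f x n) \<in> M \<rightarrow>\<^sub>M count_space UNIV" for n
      unfolding f_def by (rule measurable_compose_countable[OF step pre_meas])
    then have "(\<lambda>x i. f x i) \<in> M \<rightarrow>\<^sub>M baire_space"
      by (intro measurable_PiM_single') auto
    then show ?thesis by simp
  qed
  have branch: "x \<in> E (map (f x) [0..<n])" if "x \<in> E [] \<inter> Z" for x n
  proof (induction n)
    case 0
    then show ?case using that by simp
  next
    case (Suc n)
    then have "\<exists>k. x \<in> E (pre x n @ [k])" using that unfolding Z_def pre_f by auto
    then have "x \<in> E (pre x n @ [f x n])" unfolding f_def by (rule LeastI_ex)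
    then show ?case unfolding pre_f by simp
  qed
  show thesis
  proof
    show "E [] \<inter> Z \<in> sets M" by measurable
    show "f \<in> M \<rightarrow>\<^sub>M baire_space" by (rule f_meas)
    show "x \<in> P n (f x)" if x: "x \<in> E [] \<inter> Z" for x n
    proof -
      obtain m where m: "\<And>r'. (\<forall>i<m. r' i = f x i) \<Longrightarrow> P n r' = P n (f x)" using P_local by blast
      have "E (map (f x) [0..<m]) \<subseteq> P n (f x)"
        by (rule E_sub) (auto simp: cyl_def intro!: m)
      then show ?thesis using branch[OF x] by blast
    qed
    have "AE x in M. \<forall>l. x \<in> E l \<longrightarrow> (\<exists>k. x \<in> E (l @ [k]))" using null by (simp add: AE_all_countable)
    then show "AE x in M. (\<exists>r. \<forall>n. x \<in> P n r) \<longrightarrow> x \<in> E [] \<inter> Z"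
    proof (rule AE_mp, intro AE_I2 impI)
      fix x assume x: "x \<in> space M" "\<forall>l. x \<in> E l \<longrightarrow> (\<exists>k. x \<in> E (l @ [k]))" "\<exists>r. \<forall>n. x \<in> P n r"
      then have "x \<in> B []" unfolding B_def cyl_def by auto
      then show "x \<in> E [] \<inter> Z" using B_E x(1,2) unfolding Z_def by auto
    qed
  qed
qed

text \<open>Pulled back along the coding \<open>h\<close>, the set becomes a Borel and hence
  analytic set over the Baire space. The code of the second coordinate and the witness of membership
  are paired into one sequence; after selection of such a sequence the code is read off and decoded
  by \<open>h\<close>.\<close>

theorem ae_uniformization:
  assumes "standard_borel N" "finite_measure M" and S: "S \<in> sets (M \<Otimes>\<^sub>M N)" and ne: "space N \<noteq> {}"
  obtains A f where "A \<in> sets M" "f \<in> M \<rightarrow>\<^sub>M N" "\<And>x. x \<in> A \<Longrightarrow> (x, f x) \<in> S"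
    "AE x in M. x \<in> Domain S \<longrightarrow> x \<in> A"
proof -
  obtain h where h: "h \<in> baire_space \<rightarrow>\<^sub>M N" "space N \<subseteq> range h"
    using standard_borel_baire_coding[OF assms(1) ne] .
  define S' where "S' = {p \<in> space (M \<Otimes>\<^sub>M baire_space). (fst p, h (snd p)) \<in> S}"
  have "S' \<in> sets (M \<Otimes>\<^sub>M baire_space)" unfolding S'_def using h(1) S by measurable
  then have "S' \<in> analytic_sets M" by (rule borel_subset_analytic)
  then obtain P where P: "\<And>n. locally_const (P n)" "\<And>n s t. P n s t \<in> sets M"
    and S': "S' = {(x, s). x \<in> space M \<and> (\<exists>t. \<forall>n::nat. x \<in> P n s t)}"
    unfolding analytic_sets_def analytic_scheme_def by blast
  define l where "l r i = fst (prod_decode (r i))" for r :: "nat \<Rightarrow> nat" and i :: nat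
  define q where "q r i = snd (prod_decode (r i))" for r :: "nat \<Rightarrow> nat" and i :: nat
  define R where "R n r = P n (l r) (q r)" for n r
  have loc: "\<exists>m. \<forall>r'. (\<forall>i<m. r' i = r i) \<longrightarrow> R n r' = R n r" for n r
  proof -
    obtain m where m: "\<And>s t. (\<forall>i<m. s i = l r i \<and> t i = q r i) \<Longrightarrow> P n s t = P n (l r) (q r)"
      using P(1)[of n] unfolding locally_const_def by meson
    have "\<forall>r'. (\<forall>i<m. r' i = r i) \<longrightarrow> R n r' = R n r"
      unfolding R_def by (intro allI impI m) (simp add: l_def q_def)
    then show ?thesis by (rule exI)
  qed
  have R_sets: "R n r \<in> sets M" for n r unfolding R_def by (rule P(2))
  obtain A f where A: "A \<in> sets M" "f \<in> M \<rightarrow>\<^sub>M baire_space"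
    "\<And>x n. x \<in> A \<Longrightarrow> x \<in> R n (f x)"
    "AE x in M. (\<exists>r. \<forall>n. x \<in> R n r) \<longrightarrow> x \<in> A"
    by (rule suslin_selection[of R M, OF R_sets loc assms(2)]) (rule that)
  have "(\<lambda>x i. fst (prod_decode (f x i))) \<in> M \<rightarrow>\<^sub>M baire_space"
  proof (rule measurable_PiM_single')
    show "(\<lambda>x. fst (prod_decode (f x i))) \<in> M \<rightarrow>\<^sub>M count_space UNIV" for i
      using measurable_compose[OF measurable_compose[OF A(2) measurable_component_singleton[of i]],
          of "\<lambda>k. fst (prod_decode k)" "count_space UNIV"] by simp
  qed auto
  then have lf: "(\<lambda>x. l (f x)) \<in> M \<rightarrow>\<^sub>M baire_space" unfolding l_def .
  show thesis
  proof
    show "A \<in> sets M" by fact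
    show "(\<lambda>x. h (l (f x))) \<in> M \<rightarrow>\<^sub>M N" by (rule measurable_compose[OF lf h(1)])
    show "(x, h (l (f x))) \<in> S" if "x \<in> A" for x
    proof -
      have "(x, l (f x)) \<in> S'" unfolding S' using A(3)[OF that, unfolded R_def] A(1) that sets.sets_into_space by auto
      then show ?thesis unfolding S'_def by simp
    qed
    show "AE x in M. x \<in> Domain S \<longrightarrow> x \<in> A"
      using A(4)
    proof (rule AE_mp, intro AE_I2 impI)
      fix x assume x: "x \<in> space M" "(\<exists>r. \<forall>n. x \<in> R n r) \<longrightarrow> x \<in> A" "x \<in> Domain S"
      then obtain y where y: "(x, y) \<in> S" by auto
      then have "y \<in> space N" using sets.sets_into_space[OF S] by (auto simp: space_pair_measure)
      then obtain s where "y = h s" using h(2) by auto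
      then have "(x, s) \<in> S'" using y x(1) unfolding S'_def by (simp add: space_pair_measure space_PiM)
      then obtain t where t: "\<And>n. x \<in> P n s t" unfolding S' by auto
      define r where "r i = prod_encode (s i, t i)" for i
      have "l r = s" "q r = t" unfolding l_def q_def r_def by auto
      then show "x \<in> A" using t x(2) unfolding R_def by metis
    qed
  qed
qed

section \<open>Partial isomorphisms inside a relation\<close>

text \<open>The graph of a Borel isomorphism between Borel sets. Total maps \<open>f\<close> and
  \<open>g\<close> stand for the isomorphism and its inverse, with arbitrary values off
  \<open>A\<close> and \<open>B\<close>. For graphs, extension is inclusion and the limit of a chain
  is its union.\<close>

definition partial_iso :: "'a measure \<Rightarrow> ('a \<times> 'a) set \<Rightarrow> bool" where
  "partial_iso M G \<longleftrightarrow> (\<exists>A\<in>sets M. \<exists>B\<in>sets M. \<exists>f\<in>M \<rightarrow>\<^sub>M M. \<exists>g\<in>M \<rightarrow>\<^sub>M M.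
     (\<forall>x y. (x, y) \<in> G \<longleftrightarrow> x \<in> A \<and> y = f x) \<and> (\<forall>x y. (x, y) \<in> G \<longleftrightarrow> y \<in> B \<and> x = g y))"

lemma partial_isoI:
  assumes "A \<in> sets M" "B \<in> sets M" "f \<in> M \<rightarrow>\<^sub>M M" "g \<in> M \<rightarrow>\<^sub>M M"
    "\<And>x y. (x, y) \<in> G \<longleftrightarrow> x \<in> A \<and> y = f x" "\<And>x y. (x, y) \<in> G \<longleftrightarrow> y \<in> B \<and> x = g y"
  shows "partial_iso M G"
  unfolding partial_iso_def by (intro bexI[OF _ assms(1)] bexI[OF _ assms(2)] bexI[OF _ assms(3)]
    bexI[OF _ assms(4)] conjI allI assms(5,6))

lemma partial_isoE:
  assumes "partial_iso M G"
  obtains f g where "Domain G \<in> sets M" "Range G \<in> sets M" "f \<in> M \<rightarrow>\<^sub>M M" "g \<in> M \<rightarrow>\<^sub>M M"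
    "\<And>x y. (x, y) \<in> G \<longleftrightarrow> x \<in> Domain G \<and> y = f x" "\<And>x y. (x, y) \<in> G \<longleftrightarrow> y \<in> Range G \<and> x = g y"
proof -
  from assms obtain A B f g where *: "A \<in> sets M" "B \<in> sets M" "f \<in> M \<rightarrow>\<^sub>M M" "g \<in> M \<rightarrow>\<^sub>M M"
    and f: "\<forall>x y. (x, y) \<in> G \<longleftrightarrow> x \<in> A \<and> y = f x"
    and g: "\<forall>x y. (x, y) \<in> G \<longleftrightarrow> y \<in> B \<and> x = g y"
    unfolding partial_iso_def by (elim bexE conjE) (rule that)
  have A: "Domain G = A" by (simp add: Domain_unfold f)
  have B: "Range G = B" by (simp add: Range_iff g set_eq_iff)
  show thesis
  proof (rule that[of f g])
    show "(x, y) \<in> G \<longleftrightarrow> x \<in> Domain G \<and> y = f x" for x y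
      unfolding A by (rule f[rule_format])
    show "(x, y) \<in> G \<longleftrightarrow> y \<in> Range G \<and> x = g y" for x y
      unfolding B by (rule g[rule_format])
  qed (simp_all add: A B *)
qed

lemma partial_iso_left:
  assumes "partial_iso M G"
  shows "\<exists>f. f \<in> M \<rightarrow>\<^sub>M M \<and> (\<forall>x y. (x, y) \<in> G \<longleftrightarrow> x \<in> Domain G \<and> y = f x)"
  by (rule partial_isoE[OF assms]) (intro exI conjI allI; assumption)

lemma partial_iso_right:
  assumes "partial_iso M G"
  shows "\<exists>g. g \<in> M \<rightarrow>\<^sub>M M \<and> (\<forall>x y. (x, y) \<in> G \<longleftrightarrow> y \<in> Range G \<and> x = g y)"
  by (rule partial_isoE[OF assms]) (intro exI conjI allI; assumption)

lemma partial_iso_restrict: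
  assumes G: "partial_iso M G" and A: "A \<in> sets M" and B: "B \<in> sets M"
  shows "partial_iso M (G \<inter> A \<times> B)"
proof -
  obtain f g where fg: "Domain G \<in> sets M" "Range G \<in> sets M" "f \<in> M \<rightarrow>\<^sub>M M" "g \<in> M \<rightarrow>\<^sub>M M"
    and *: "\<And>x y. (x, y) \<in> G \<longleftrightarrow> x \<in> Domain G \<and> y = f x" "\<And>x y. (x, y) \<in> G \<longleftrightarrow> y \<in> Range G \<and> x = g y"
    by (rule partial_isoE[OF G]) (rule that)
  show ?thesis
  proof (rule partial_isoI)
    show "(f -` B \<inter> space M) \<inter> (Domain G \<inter> A) \<in> sets M"
      using fg A B by (intro sets.Int measurable_sets)
    show "(g -` A \<inter> space M) \<inter> (Range G \<inter> B) \<in> sets M"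
      using fg A B by (intro sets.Int measurable_sets)
    show "f \<in> M \<rightarrow>\<^sub>M M" "g \<in> M \<rightarrow>\<^sub>M M" by fact+
    show "(x, y) \<in> G \<inter> A \<times> B \<longleftrightarrow> x \<in> (f -` B \<inter> space M) \<inter> (Domain G \<inter> A) \<and> y = f x" for x y
      using *(1)[of x y] sets.sets_into_space[OF fg(1)] by auto
    show "(x, y) \<in> G \<inter> A \<times> B \<longleftrightarrow> y \<in> (g -` A \<inter> space M) \<inter> (Range G \<inter> B) \<and> x = g y" for x y
      using *(2)[of x y] sets.sets_into_space[OF fg(2)] by auto
  qed
qed

lemma partial_iso_Un:
  assumes G: "partial_iso M G" and H: "partial_iso M H"
    and disj: "Domain G \<inter> Domain H = {}" "Range G \<inter> Range H = {}"
  shows "partial_iso M (G \<union> H)"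
proof -
  obtain f g where fg: "Domain G \<in> sets M" "Range G \<in> sets M" "f \<in> M \<rightarrow>\<^sub>M M" "g \<in> M \<rightarrow>\<^sub>M M"
    and *: "\<And>x y. (x, y) \<in> G \<longleftrightarrow> x \<in> Domain G \<and> y = f x" "\<And>x y. (x, y) \<in> G \<longleftrightarrow> y \<in> Range G \<and> x = g y"
    by (rule partial_isoE[OF G]) (rule that)
  obtain f' g' where fg': "Domain H \<in> sets M" "Range H \<in> sets M" "f' \<in> M \<rightarrow>\<^sub>M M" "g' \<in> M \<rightarrow>\<^sub>M M"
    and fg'_iff: "\<And>x y. (x, y) \<in> H \<longleftrightarrow> x \<in> Domain H \<and> y = f' x" "\<And>x y. (x, y) \<in> H \<longleftrightarrow> y \<in> Range H \<and> x = g' y"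
    by (rule partial_isoE[OF H]) (rule that)
  show ?thesis
  proof (rule partial_isoI)
    show "Domain G \<union> Domain H \<in> sets M" "Range G \<union> Range H \<in> sets M" using fg fg' by auto
    show "(\<lambda>x. if x \<in> Domain G then f x else f' x) \<in> M \<rightarrow>\<^sub>M M"
      using fg fg' by (intro measurable_If_set) (auto intro: sets.Int)
    show "(\<lambda>x. if x \<in> Range G then g x else g' x) \<in> M \<rightarrow>\<^sub>M M"
      using fg fg' by (intro measurable_If_set) (auto intro: sets.Int)
    show "(x, y) \<in> G \<union> H \<longleftrightarrow> x \<in> Domain G \<union> Domain H \<and> y = (if x \<in> Domain G then f x else f' x)" for x y
      using *(1)[of x y] fg'_iff(1)[of x y] disj(1) by (metis IntI Un_iff empty_iff)
    show "(x, y) \<in> G \<union> H \<longleftrightarrow> y \<in> Range G \<union> Range H \<and> x = (if y \<in> Range G then g y else g' y)" for x y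
      using *(2)[of x y] fg'_iff(2)[of x y] disj(2) by (metis IntI Un_iff empty_iff)
  qed
qed

text \<open>The piece used at a point is the first one whose domain contains it. This index is
  measurable, and by monotonicity the later pieces agree with that choice.\<close>

lemma partial_iso_incseq_UN:
  assumes G: "\<And>n. partial_iso M (G n)" and inc: "incseq G"
  shows "partial_iso M (\<Union>n. G n)"
proof -
  obtain f where f': "\<forall>n. f n \<in> M \<rightarrow>\<^sub>M M \<and> (\<forall>x y. (x, y) \<in> G n \<longleftrightarrow> x \<in> Domain (G n) \<and> y = f n x)"
    using choice[OF allI[OF partial_iso_left[OF G]]] by (rule exE)
  obtain g where g': "\<forall>n. g n \<in> M \<rightarrow>\<^sub>M M \<and> (\<forall>x y. (x, y) \<in> G n \<longleftrightarrow> y \<in> Range (G n) \<and> x = g n y)"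
    using choice[OF allI[OF partial_iso_right[OF G]]] by (rule exE)
  have f: "f n \<in> M \<rightarrow>\<^sub>M M" for n by (rule f'[rule_format, THEN conjunct1])
  have Gf: "(x, y) \<in> G n \<longleftrightarrow> x \<in> Domain (G n) \<and> y = f n x" for n x y
    by (rule f'[rule_format, THEN conjunct2, rule_format])
  have g: "g n \<in> M \<rightarrow>\<^sub>M M" for n by (rule g'[rule_format, THEN conjunct1])
  have Gg: "(x, y) \<in> G n \<longleftrightarrow> y \<in> Range (G n) \<and> x = g n y" for n x y
    by (rule g'[rule_format, THEN conjunct2, rule_format])
  have dom [measurable]: "Domain (G n) \<in> sets M" and ran [measurable]: "Range (G n) \<in> sets M" for n
    by (rule partial_isoE[OF G[of n]], assumption)+
  define k where "k x = (LEAST n. x \<in> Domain (G n))" for x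
  define l where "l y = (LEAST n. y \<in> Range (G n))" for y
  have k_meas: "k \<in> M \<rightarrow>\<^sub>M count_space UNIV" and l_meas: "l \<in> M \<rightarrow>\<^sub>M count_space UNIV"
    unfolding k_def l_def by measurable
  have mono: "G m \<subseteq> G n" if "m \<le> n" for m n using inc that by (auto simp: incseq_def)
  show ?thesis
  proof (rule partial_isoI)
    show "(\<Union>n. Domain (G n)) \<in> sets M" "(\<Union>n. Range (G n)) \<in> sets M" by measurable
    show "(\<lambda>x. f (k x) x) \<in> M \<rightarrow>\<^sub>M M" by (rule measurable_compose_countable[OF f k_meas])
    show "(\<lambda>x. g (l x) x) \<in> M \<rightarrow>\<^sub>M M" by (rule measurable_compose_countable[OF g l_meas])
    show "(x, y) \<in> (\<Union>n. G n) \<longleftrightarrow> x \<in> (\<Union>n. Domain (G n)) \<and> y = f (k x) x" for x y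
    proof
      assume "(x, y) \<in> (\<Union>n. G n)"
      then obtain n where n: "(x, y) \<in> G n" by auto
      then have "x \<in> Domain (G (k x))" "k x \<le> n" unfolding k_def by (auto intro: LeastI Least_le)
      then have "(x, f (k x) x) \<in> G n" using mono Gf by blast
      then have "y = f (k x) x" using n Gf by metis
      then show "x \<in> (\<Union>n. Domain (G n)) \<and> y = f (k x) x" using n by auto
    next
      assume *: "x \<in> (\<Union>n. Domain (G n)) \<and> y = f (k x) x"
      then obtain n where "x \<in> Domain (G n)" by auto
      then have "x \<in> Domain (G (k x))" unfolding k_def by (rule LeastI)
      then show "(x, y) \<in> (\<Union>n. G n)" using Gf * by blast
    qed
    show "(x, y) \<in> (\<Union>n. G n) \<longleftrightarrow> y \<in> (\<Union>n. Range (G n)) \<and> x = g (l y) y" for x y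
    proof
      assume "(x, y) \<in> (\<Union>n. G n)"
      then obtain n where n: "(x, y) \<in> G n" by auto
      then have "y \<in> Range (G (l y))" "l y \<le> n" unfolding l_def by (auto intro: LeastI Least_le)
      then have "(g (l y) y, y) \<in> G n" using mono Gg by blast
      then have "x = g (l y) y" using n Gg by metis
      then show "y \<in> (\<Union>n. Range (G n)) \<and> x = g (l y) y" using n by auto
    next
      assume *: "y \<in> (\<Union>n. Range (G n)) \<and> x = g (l y) y"
      then obtain n where "y \<in> Range (G n)" by auto
      then have "y \<in> Range (G (l y))" unfolding l_def by (rule LeastI)
      then show "(x, y) \<in> (\<Union>n. G n)" using Gg * by blast
    qed
  qed
qed

section \<open>Conull sets and almost everywhere statements\<close>

lemma AE_conull_set:
  assumes "AE x in M. P x"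
  obtains X where "X \<in> conull_sets M" "\<And>x. x \<in> X \<Longrightarrow> P x"
proof -
  obtain N where N: "N \<in> null_sets M" "{x \<in> space M. \<not> P x} \<subseteq> N"
    using assms by (auto simp: eventually_ae_filter)
  then have "space M - N \<in> conull_sets M"
    unfolding conull_sets_def by (auto intro: null_sets_subset)
  then show thesis by (rule that) (use N(2) in auto)
qed

lemma conull_set_AE: "X \<in> conull_sets M \<Longrightarrow> AE x in M. x \<in> X"
  unfolding conull_sets_def by (auto intro!: AE_I')

lemma conull_setsD: "X \<in> conull_sets M \<Longrightarrow> X \<in> sets M" "X \<in> conull_sets M \<Longrightarrow> x \<in> X \<Longrightarrow> x \<in> space M"
  unfolding conull_sets_def using sets.sets_into_space by auto

lemma conull_setsI: "X \<in> sets M \<Longrightarrow> AE x in M. x \<in> X \<Longrightarrow> X \<in> conull_sets M"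
  unfolding conull_sets_def by (auto simp: AE_iff_null set_diff_eq)

lemma not_AE_not_in:
  assumes "B \<in> sets M" "emeasure M B \<noteq> 0"
  shows "\<not> (AE x in M. x \<notin> B)"
proof
  assume "AE x in M. x \<notin> B"
  then have "emeasure M B = emeasure M {}" using assms(1) by (intro emeasure_eq_AE) auto
  then show False using assms(2) by simp
qed

locale standard_prob_space = prob_space M for M :: "'a measure" +
  assumes standard: "standard_borel M"
begin

lemma space_ne: "space M \<noteq> {}"
  by (rule not_empty)

lemma graph_sets:
  assumes [measurable]: "A \<in> sets M" "f \<in> M \<rightarrow>\<^sub>M M"
  shows "{(x, f x) |x. x \<in> A} \<in> sets (M \<Otimes>\<^sub>M M)"
proof -
  let ?D = "{(x, y). x \<in> space M \<and> x = y}"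
  have [measurable]: "?D \<in> sets (M \<Otimes>\<^sub>M M)" by (rule standard_borel_diagonal[OF standard])
  have "{(x, f x) |x. x \<in> A} = {p \<in> space (M \<Otimes>\<^sub>M M). fst p \<in> A \<and> (f (fst p), snd p) \<in> ?D}"
    using sets.sets_into_space[OF assms(1)] measurable_space[OF assms(2)]
    by (auto simp: space_pair_measure)
  also have "\<dots> \<in> sets (M \<Otimes>\<^sub>M M)" by measurable
  finally show ?thesis .
qed

lemma uniformize:
  assumes "S \<in> sets (M \<Otimes>\<^sub>M M)"
  obtains A f where "A \<in> sets M" "f \<in> M \<rightarrow>\<^sub>M M" "\<And>x. x \<in> A \<Longrightarrow> (x, f x) \<in> S"
    "AE x in M. x \<in> Domain S \<longrightarrow> x \<in> A"
  by (rule ae_uniformization[OF standard finite_measure_axioms assms space_ne]) (rule that)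

text \<open>A projection need not be measurable; the domain of an almost everywhere selector lies
  inside it and is a measurable substitute.\<close>

lemma Domain_AE_measurable:
  assumes "S \<in> sets (M \<Otimes>\<^sub>M M)"
  obtains A where "A \<in> sets M" "AE x in M. x \<in> Domain S \<longleftrightarrow> x \<in> A"
proof -
  obtain A f where A: "A \<in> sets M" "f \<in> M \<rightarrow>\<^sub>M M" "\<And>x. x \<in> A \<Longrightarrow> (x, f x) \<in> S"
    "AE x in M. x \<in> Domain S \<longrightarrow> x \<in> A"
    by (rule uniformize[OF assms]) (rule that)
  have "AE x in M. x \<in> Domain S \<longleftrightarrow> x \<in> A"
    using A(4) by eventually_elim (use A(3) in blast)
  with A(1) show thesis by (rule that)
qed

end

section \<open>Measure-preserving relations and the saturation of null sets\<close>

locale pmp_relation = standard_prob_space M for M :: "'a measure" +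
  fixes V :: "('a \<times> 'a) set"
  assumes V_discrete: "discrete_borel_equiv M V" and V_pmp: "pmp_rel M V"
begin

lemma V_sets [measurable]: "V \<in> sets (M \<Otimes>\<^sub>M M)"
  using V_discrete unfolding discrete_borel_equiv_def by blast

lemma V_equiv: "equiv (space M) V"
  using V_discrete unfolding discrete_borel_equiv_def by blast

lemma V_space: "(x, y) \<in> V \<Longrightarrow> x \<in> space M" "(x, y) \<in> V \<Longrightarrow> y \<in> space M"
  using sets.sets_into_space[OF V_sets] by (auto simp: space_pair_measure)

lemma V_refl: "x \<in> space M \<Longrightarrow> (x, x) \<in> V"
  using V_equiv by (auto simp: equiv_def refl_on_def)

lemma V_sym: "(x, y) \<in> V \<Longrightarrow> (y, x) \<in> V"
  using V_equiv by (auto simp: equiv_def sym_def)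

lemma V_trans: "(x, y) \<in> V \<Longrightarrow> (y, z) \<in> V \<Longrightarrow> (x, z) \<in> V"
  using V_equiv by (auto simp: equiv_def trans_def)

text \<open>Rows and columns of such a graph have at most one point, so its \<open>mu_L\<close> and
  \<open>mu_R\<close> are the measures of domain and range.\<close>

lemma partial_iso_measure:
  assumes G: "partial_iso M G" and "G \<subseteq> V"
  shows "emeasure M (Domain G) = emeasure M (Range G)"
proof -
  obtain f g where fg [measurable]: "Domain G \<in> sets M" "Range G \<in> sets M" "f \<in> M \<rightarrow>\<^sub>M M" "g \<in> M \<rightarrow>\<^sub>M M"
    and *: "\<And>x y. (x, y) \<in> G \<longleftrightarrow> x \<in> Domain G \<and> y = f x" "\<And>x y. (x, y) \<in> G \<longleftrightarrow> y \<in> Range G \<and> x = g y"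
    by (rule partial_isoE[OF G]) (rule that)
  have "G = {(x, f x) |x. x \<in> Domain G}" using *(1) by auto
  then have "G \<in> sets (M \<Otimes>\<^sub>M M)" using graph_sets[OF fg(1) fg(3)] by simp
  then have eq: "mu_L M G = mu_R M G" using V_pmp \<open>G \<subseteq> V\<close> unfolding pmp_rel_def by blast
  have "{y. (x, y) \<in> G} = (if x \<in> Domain G then {f x} else {})" for x using *(1)[of x] by auto
  then have "mu_L M G = (\<integral>\<^sup>+x. indicator (Domain G) x \<partial>M)"
    unfolding mu_L_def by (intro nn_integral_cong) (auto simp: emeasure_count_space)
  moreover have "{x. (x, y) \<in> G} = (if y \<in> Range G then {g y} else {})" for y using *(2)[of _ y] by auto
  then have "mu_R M G = (\<integral>\<^sup>+x. indicator (Range G) x \<partial>M)"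
    unfolding mu_R_def by (intro nn_integral_cong) (auto simp: emeasure_count_space)
  ultimately show ?thesis using eq fg(1,2) by simp
qed

text \<open>Uniformizing twice, first along the rows and then along the columns of the resulting graph,
  makes the selected map injective.\<close>

lemma positive_partial_iso:
  assumes S: "S \<in> sets (M \<Otimes>\<^sub>M M)" "S \<subseteq> V" and pos: "\<not> (AE x in M. x \<notin> Domain S)"
  obtains G where "partial_iso M G" "G \<subseteq> S" "emeasure M (Domain G) \<noteq> 0"
proof -
  obtain A f where A [measurable]: "A \<in> sets M" "f \<in> M \<rightarrow>\<^sub>M M"
    and f: "\<And>x. x \<in> A \<Longrightarrow> (x, f x) \<in> S" and AE: "AE x in M. x \<in> Domain S \<longrightarrow> x \<in> A"
    by (rule uniformize[OF S(1)]) (rule that)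
  have A_pos: "emeasure M A \<noteq> 0"
  proof
    assume "emeasure M A = 0"
    then have "AE x in M. x \<notin> A" using A(1) by (intro AE_not_in) auto
    with AE have "AE x in M. x \<notin> Domain S" by eventually_elim auto
    then show False using pos by simp
  qed
  define F where "F = {(x, f x) |x. x \<in> A}"
  have F: "F \<in> sets (M \<Otimes>\<^sub>M M)" unfolding F_def by (rule graph_sets) fact+
  have "F \<subseteq> S" using f unfolding F_def by auto
  then have eq: "mu_L M F = mu_R M F" using V_pmp S(2) F unfolding pmp_rel_def by blast
  have "{y. (x, y) \<in> F} = (if x \<in> A then {f x} else {})" for x unfolding F_def by auto
  then have "mu_L M F = (\<integral>\<^sup>+x. indicator A x \<partial>M)"
    unfolding mu_L_def by (intro nn_integral_cong) (auto simp: emeasure_count_space)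
  \<comment> \<open>Equality of the two measures passes positivity from rows to columns, so the
    second uniformization has a non-null domain.\<close>
  then have mu: "mu_R M F \<noteq> 0" using A_pos eq by simp
  define F' where "F' = {p \<in> space (M \<Otimes>\<^sub>M M). (snd p, fst p) \<in> F}"
  have F': "F' \<in> sets (M \<Otimes>\<^sub>M M)" unfolding F'_def using F by measurable
  have F'_iff: "(y, x) \<in> F' \<longleftrightarrow> (x, y) \<in> F" for x y
    using sets.sets_into_space[OF F] unfolding F'_def by (auto simp: space_pair_measure)
  obtain B g where B [measurable]: "B \<in> sets M" "g \<in> M \<rightarrow>\<^sub>M M"
    and g: "\<And>y. y \<in> B \<Longrightarrow> (y, g y) \<in> F'" and AE': "AE y in M. y \<in> Domain F' \<longrightarrow> y \<in> B"
    by (rule uniformize[OF F']) (rule that)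
  have B_pos: "emeasure M B \<noteq> 0"
  proof
    assume "emeasure M B = 0"
    then have "AE x in M. x \<notin> B" using B(1) by (intro AE_not_in) auto
    with AE' have "AE y in M. emeasure (count_space UNIV) {x. (x, y) \<in> F} = 0"
    proof eventually_elim
      case (elim y)
      then have "{x. (x, y) \<in> F} = {}" using F'_iff by blast
      then show ?case by simp
    qed
    then have "mu_R M F = (\<integral>\<^sup>+y. 0 \<partial>M)" unfolding mu_R_def by (rule nn_integral_cong_AE)
    then show False using mu by simp
  qed
  have gf: "g y \<in> A" "y = f (g y)" if "y \<in> B" for y
    using g[OF that] unfolding F'_iff F_def by auto
  define G where "G = {(g y, y) |y. y \<in> B}"
  let ?D = "{(x, y). x \<in> space M \<and> x = y}"
  have [measurable]: "?D \<in> sets (M \<Otimes>\<^sub>M M)" by (rule standard_borel_diagonal[OF standard])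
  have "partial_iso M G"
  proof (rule partial_isoI)
    \<comment> \<open>The domain of \<open>G\<close> consists of the points of \<open>A\<close> at
      which \<open>g\<close> undoes \<open>f\<close>; the diagonal makes this equation
      measurable.\<close>
    show "{x \<in> space M. x \<in> A \<and> f x \<in> B \<and> (g (f x), x) \<in> ?D} \<in> sets M" by measurable
    show "B \<in> sets M" "f \<in> M \<rightarrow>\<^sub>M M" "g \<in> M \<rightarrow>\<^sub>M M" by fact+
    show "(x, y) \<in> G \<longleftrightarrow> y \<in> B \<and> x = g y" for x y unfolding G_def by auto
    show "(x, y) \<in> G \<longleftrightarrow> x \<in> {x \<in> space M. x \<in> A \<and> f x \<in> B \<and> (g (f x), x) \<in> ?D} \<and> y = f x" for x y
      unfolding G_def using gf sets.sets_into_space[OF A(1)] measurable_space[OF A(2)] by auto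
  qed
  moreover have "G \<subseteq> V"
    using gf f S(2) unfolding G_def by fastforce
  moreover have "Range G = B" unfolding G_def by auto
  ultimately have "emeasure M (Domain G) \<noteq> 0" using partial_iso_measure[of G] B_pos by simp
  moreover have "G \<subseteq> S" using gf f unfolding G_def by fastforce
  ultimately show thesis using that \<open>partial_iso M G\<close> by blast
qed

text \<open>If the saturation of a null set were not null, a partial isomorphism inside the relation
  would carry a non-null set into the null set.\<close>

lemma AE_saturate:
  assumes "AE x in M. P x"
  shows "AE x in M. \<forall>y. (x, y) \<in> V \<longrightarrow> P y"
proof -
  obtain X where X: "X \<in> conull_sets M" "\<And>x. x \<in> X \<Longrightarrow> P x" using AE_conull_set[OF assms] by blast
  define N where "N = space M - X"
  have N: "N \<in> sets M" "emeasure M N = 0" using X(1) unfolding N_def conull_sets_def by auto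
  define S where "S = V \<inter> space M \<times> N"
  have S: "S \<in> sets (M \<Otimes>\<^sub>M M)" unfolding S_def using N(1) by auto
  have "AE x in M. x \<notin> Domain S"
  proof (rule ccontr)
    assume "\<not> (AE x in M. x \<notin> Domain S)"
    then obtain G where G: "partial_iso M G" "G \<subseteq> S" "emeasure M (Domain G) \<noteq> 0"
      using positive_partial_iso[OF S] unfolding S_def by blast
    have "emeasure M (Range G) \<le> emeasure M N"
      using G(2) N(1) unfolding S_def by (intro emeasure_mono) auto
    moreover have "G \<subseteq> V" using G(2) unfolding S_def by auto
    ultimately show False using partial_iso_measure[OF G(1)] G(3) N(2) by simp
  qed
  then show ?thesis
    by (rule AE_mp) (auto simp: S_def N_def Domain_iff dest: V_space intro!: AE_I2 X(2))
qed

text \<open>The points whose class lies in a conull set are only known to contain a conull Borel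
  set, which need not be invariant. Iteration gives a decreasing sequence in which the class of a
  point of each set lies in the preceding set; the intersection is invariant.\<close>

lemma AE_invariant_conull:
  assumes "AE x in M. P x"
  obtains X where "X \<in> conull_sets M" "\<And>x. x \<in> X \<Longrightarrow> P x" "\<And>x y. x \<in> X \<Longrightarrow> (x, y) \<in> V \<Longrightarrow> y \<in> X"
proof -
  obtain X0 where X0: "X0 \<in> conull_sets M" "\<And>x. x \<in> X0 \<Longrightarrow> P x" using AE_conull_set[OF assms] by blast
  have step: "\<exists>Y. Y \<in> conull_sets M \<and> Y \<subseteq> X \<and> (\<forall>x\<in>Y. \<forall>y. (x, y) \<in> V \<longrightarrow> y \<in> X)"
    if X: "X \<in> conull_sets M" for X
  proof -
    have "AE x in M. x \<in> X \<and> (\<forall>y. (x, y) \<in> V \<longrightarrow> y \<in> X)"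
      using conull_set_AE[OF X] AE_saturate[OF conull_set_AE[OF X]] by eventually_elim auto
    then obtain Y where "Y \<in> conull_sets M" "\<And>x. x \<in> Y \<Longrightarrow> x \<in> X \<and> (\<forall>y. (x, y) \<in> V \<longrightarrow> y \<in> X)"
      using AE_conull_set by blast
    then show ?thesis by blast
  qed
  have "\<exists>X. \<forall>n::nat. (X n \<in> conull_sets M \<and> (n = 0 \<longrightarrow> X n = X0)) \<and>
      (X (Suc n) \<subseteq> X n \<and> (\<forall>x\<in>X (Suc n). \<forall>y. (x, y) \<in> V \<longrightarrow> y \<in> X n))"
    by (rule dependent_nat_choice[where P = "\<lambda>n Y. Y \<in> conull_sets M \<and> (n = 0 \<longrightarrow> Y = X0)"
      and Q = "\<lambda>_ X Y. Y \<subseteq> X \<and> (\<forall>x\<in>Y. \<forall>y. (x, y) \<in> V \<longrightarrow> y \<in> X)"])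
      (use X0(1) step in auto)
  then obtain X where X': "\<forall>n::nat. (X n \<in> conull_sets M \<and> (n = 0 \<longrightarrow> X n = X0)) \<and>
      (X (Suc n) \<subseteq> X n \<and> (\<forall>x\<in>X (Suc n). \<forall>y. (x, y) \<in> V \<longrightarrow> y \<in> X n))" by (rule exE)
  have X: "\<And>n. X n \<in> conull_sets M" "X 0 = X0"
    "\<And>n x y. x \<in> X (Suc n) \<Longrightarrow> (x, y) \<in> V \<Longrightarrow> y \<in> X n"
    using X' by simp_all
  show thesis
  proof
    show "(\<Inter>n. X n) \<in> conull_sets M"
    proof (rule conull_setsI)
      show "(\<Inter>n. X n) \<in> sets M" using conull_setsD(1)[OF X(1)] by auto
      have "AE x in M. \<forall>n. x \<in> X n" using conull_set_AE[OF X(1)] by (simp add: AE_all_countable)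
      then show "AE x in M. x \<in> (\<Inter>n. X n)" by simp
    qed
    show "P x" if "x \<in> (\<Inter>n. X n)" for x using that X(2) X0(2) by auto
    show "y \<in> (\<Inter>n. X n)" if "x \<in> (\<Inter>n. X n)" "(x, y) \<in> V" for x y using X(3) that by blast
  qed
qed

end

section \<open>Extending partial isomorphisms\<close>

lemma mp_mapsI:
  assumes f: "f \<in> M \<rightarrow>\<^sub>M M" and g: "g \<in> M \<rightarrow>\<^sub>M M"
    and gf: "\<And>x. x \<in> space M \<Longrightarrow> g (f x) = x" and fg: "\<And>x. x \<in> space M \<Longrightarrow> f (g x) = x"
    and "distr M M f = M"
  shows "f \<in> mp_maps M"
proof -
  have bij: "bij_betw f (space M) (space M)"
    using gf fg measurable_space[OF f] measurable_space[OF g]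
    by (intro bij_betw_byWitness[of _ g]) auto
  moreover have "the_inv_into (space M) f x = g x" if "x \<in> space M" for x
    using bij that fg measurable_space[OF g]
    by (intro the_inv_into_f_eq) (auto simp: bij_betw_def)
  then have "the_inv_into (space M) f \<in> M \<rightarrow>\<^sub>M M" using g measurable_cong by blast
  ultimately show ?thesis using f assms(5) unfolding mp_maps_def by simp
qed

context pmp_relation
begin

text \<open>Unions of uncountable chains could destroy measurability, so the domain is exhausted by
  measure: stage \<open>n\<close> takes an extension whose domain comes within
  \<open>1 / Suc n\<close> of the supremum over all extensions of the current one. The union of the
  stages is maximal in measure.\<close>

lemma maximal_partial_iso:
  assumes "partial_iso M G0" "G0 \<subseteq> S"
  obtains G where "partial_iso M G" "G0 \<subseteq> G" "G \<subseteq> S"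
    "\<And>K. partial_iso M K \<Longrightarrow> G \<subseteq> K \<Longrightarrow> K \<subseteq> S \<Longrightarrow> measure M (Domain K) \<le> measure M (Domain G)"
proof -
  define \<G> where "\<G> = {G. partial_iso M G \<and> G0 \<subseteq> G \<and> G \<subseteq> S}"
  let ?m = "\<lambda>G. measure M (Domain G)"
  have dom: "Domain G \<in> sets M" if "partial_iso M G" for G by (rule partial_isoE[OF that])
  have step: "\<exists>H. H \<in> \<G> \<and> G \<subseteq> H \<and> (\<forall>K\<in>\<G>. G \<subseteq> K \<longrightarrow> ?m K < ?m H + 1 / Suc n)"
    if G: "G \<in> \<G>" for G and n :: nat
  proof -
    define T where "T = ?m ` {K\<in>\<G>. G \<subseteq> K}"
    have T: "T \<noteq> {}" "bdd_above T" using G unfolding T_def by (auto intro!: bdd_aboveI[of _ 1])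
    have "Sup T - 1 / Suc n < Sup T" by simp
    then obtain t where "t \<in> T" "Sup T - 1 / Suc n < t" using less_cSup_iff[OF T] by blast
    then obtain H where H: "H \<in> \<G>" "G \<subseteq> H" "Sup T - 1 / Suc n < ?m H" unfolding T_def by auto
    have "?m K \<le> Sup T" if "K \<in> \<G>" "G \<subseteq> K" for K
      using that T(2) unfolding T_def by (intro cSup_upper) auto
    then show ?thesis using H by force
  qed
  have "G0 \<in> \<G>" using assms unfolding \<G>_def by auto
  have "\<exists>G. \<forall>n::nat. G n \<in> \<G> \<and> (G n \<subseteq> G (Suc n) \<and> (\<forall>K\<in>\<G>. G n \<subseteq> K \<longrightarrow> ?m K < ?m (G (Suc n)) + 1 / Suc n))"
    by (rule dependent_nat_choice[where P = "\<lambda>_ G. G \<in> \<G>"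
      and Q = "\<lambda>n G H. G \<subseteq> H \<and> (\<forall>K\<in>\<G>. G \<subseteq> K \<longrightarrow> ?m K < ?m H + 1 / Suc n)"])
      (use \<open>G0 \<in> \<G>\<close> step in auto)
  then obtain G where G': "\<forall>n::nat. G n \<in> \<G> \<and> (G n \<subseteq> G (Suc n) \<and> (\<forall>K\<in>\<G>. G n \<subseteq> K \<longrightarrow> ?m K < ?m (G (Suc n)) + 1 / Suc n))"
    by (rule exE)
  then have G: "G n \<in> \<G>" "G n \<subseteq> G (Suc n)"
    "K \<in> \<G> \<Longrightarrow> G n \<subseteq> K \<Longrightarrow> ?m K < ?m (G (Suc n)) + 1 / Suc n" for n K
    by auto
  let ?G = "\<Union>n. G n"
  have pG: "partial_iso M ?G"
    using G(1,2) unfolding \<G>_def by (intro partial_iso_incseq_UN incseq_SucI) auto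
  show thesis
  proof
    show "partial_iso M ?G" by (rule pG)
    show "G0 \<subseteq> ?G" using G(1)[of 0] unfolding \<G>_def by auto
    show "?G \<subseteq> S" using G(1) unfolding \<G>_def by auto
    fix K assume K: "partial_iso M K" "?G \<subseteq> K" "K \<subseteq> S"
    then have "K \<in> \<G>" using \<open>G0 \<subseteq> ?G\<close> unfolding \<G>_def by auto
    have *: "?m K < ?m ?G + 1 / Suc n" for n
    proof -
      have "?m K < ?m (G (Suc n)) + 1 / Suc n" using K(2) by (intro G(3)[OF \<open>K \<in> \<G>\<close>]) auto
      also have "?m (G (Suc n)) \<le> ?m ?G" by (intro finite_measure_mono dom[OF pG]) auto
      finally show ?thesis by simp
    qed
    show "?m K \<le> ?m ?G"
    proof (rule field_le_epsilon)
      fix e :: real assume "e > 0"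
      then obtain n where "1 / Suc n < e" using nat_approx_posE by metis
      then show "?m K \<le> ?m ?G + e" using *[of n] by linarith
    qed
  qed
qed

text \<open>Domain and range of a maximal extension have complements of equal measure. Were it
  positive, \<open>reach\<close> would supply pairs of \<open>S\<close> between the complements, and
  a partial isomorphism among them would enlarge the extension. The hypothesis \<open>reach\<close>
  stands in for ergodicity because \<open>S\<close> may be smaller than the relation, for instance
  one fiber of a cocycle.\<close>

theorem partial_iso_extends:
  assumes S: "S \<in> sets (M \<Otimes>\<^sub>M M)" "S \<subseteq> V" and G0: "partial_iso M G0" "G0 \<subseteq> S"
    and reach: "\<And>B. B \<in> sets M \<Longrightarrow> emeasure M B \<noteq> 0 \<Longrightarrow> AE x in M. \<exists>y\<in>B. (x, y) \<in> S"
  obtains \<phi> where "\<phi> \<in> mp_maps M" "AE x in M. (x, \<phi> x) \<in> S"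
    "AE x in M. x \<in> Domain G0 \<longrightarrow> (x, \<phi> x) \<in> G0"
proof -
  obtain G where G: "partial_iso M G" "G0 \<subseteq> G" "G \<subseteq> S"
    and max: "\<And>K. partial_iso M K \<Longrightarrow> G \<subseteq> K \<Longrightarrow> K \<subseteq> S \<Longrightarrow> measure M (Domain K) \<le> measure M (Domain G)"
    by (rule maximal_partial_iso[OF G0]) (rule that)
  have "G \<subseteq> V" using G(3) S(2) by blast
  obtain f g where fg: "Domain G \<in> sets M" "Range G \<in> sets M" "f \<in> M \<rightarrow>\<^sub>M M" "g \<in> M \<rightarrow>\<^sub>M M"
    and Gf: "\<And>x y. (x, y) \<in> G \<longleftrightarrow> x \<in> Domain G \<and> y = f x"
    and Gg: "\<And>x y. (x, y) \<in> G \<longleftrightarrow> y \<in> Range G \<and> x = g y"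
    by (rule partial_isoE[OF G(1)]) (rule that)
  define A where "A = space M - Domain G"
  define B where "B = space M - Range G"
  have AB [measurable]: "A \<in> sets M" "B \<in> sets M" using fg unfolding A_def B_def by auto
  have eqAB: "emeasure M A = emeasure M B"
    unfolding A_def B_def using partial_iso_measure[OF G(1) \<open>G \<subseteq> V\<close>] fg
    by (simp add: emeasure_compl)
  have A0: "emeasure M A = 0"
  proof (rule ccontr)
    assume pos: "emeasure M A \<noteq> 0"
    let ?S = "S \<inter> A \<times> B"
    have "\<not> (AE x in M. x \<notin> Domain ?S)"
    proof
      assume "AE x in M. x \<notin> Domain ?S"
      moreover have "AE x in M. \<exists>y\<in>B. (x, y) \<in> S" using reach[OF AB(2)] pos eqAB by simp
      ultimately have "AE x in M. x \<notin> A" by eventually_elim auto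
      then show False using not_AE_not_in[OF AB(1) pos] by simp
    qed
    moreover have "?S \<in> sets (M \<Otimes>\<^sub>M M)" using S(1) AB by auto
    ultimately obtain H where H: "partial_iso M H" "H \<subseteq> ?S" "emeasure M (Domain H) \<noteq> 0"
      using positive_partial_iso[of ?S] S(2) by blast
    have disj: "Domain G \<inter> Domain H = {}" "Range G \<inter> Range H = {}"
      using H(2) unfolding A_def B_def by auto
    have dH: "Domain H \<in> sets M" by (rule partial_isoE[OF H(1)])
    have "measure M (Domain (G \<union> H)) \<le> measure M (Domain G)"
      using H(2) G(3) by (intro max partial_iso_Un G(1) H(1) disj) auto
    moreover have "measure M (Domain (G \<union> H)) = measure M (Domain G) + measure M (Domain H)"
      unfolding Domain_Un_eq by (rule finite_measure_Union[OF fg(1) dH disj(1)])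
    ultimately show False using H(3) by (simp add: emeasure_eq_measure measure_le_0_iff)
  qed
  have "AE x in M. x \<notin> A" "AE x in M. x \<notin> B" using A0 eqAB AB by (auto intro!: AE_not_in)
  with AE_space have "AE x in M. x \<in> Domain G \<and> x \<in> Range G"
    by eventually_elim (auto simp: A_def B_def)
  \<comment> \<open>An invariant conull set is mapped into itself by both \<open>f\<close> and
    \<open>g\<close>, so continuing by the identity outside gives a bijection of the whole
    space.\<close>
  then obtain X where X: "X \<in> conull_sets M" "\<And>x. x \<in> X \<Longrightarrow> x \<in> Domain G \<and> x \<in> Range G"
    "\<And>x y. x \<in> X \<Longrightarrow> (x, y) \<in> V \<Longrightarrow> y \<in> X"
    by (rule AE_invariant_conull) (rule that)
  have X_sets [measurable]: "X \<in> sets M" and X_space: "\<And>x. x \<in> X \<Longrightarrow> x \<in> space M"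
    using conull_setsD X(1) by auto
  note X_AE = conull_set_AE[OF X(1)]
  have fX: "(x, f x) \<in> G" "f x \<in> X" "g (f x) = x" if "x \<in> X" for x
  proof -
    show *: "(x, f x) \<in> G" using Gf[of x "f x"] X(2)[OF that] by simp
    then show "f x \<in> X" using \<open>G \<subseteq> V\<close> X(3) that by blast
    show "g (f x) = x" using * Gg[of x "f x"] by simp
  qed
  have gX: "(g x, x) \<in> G" "g x \<in> X" "f (g x) = x" if "x \<in> X" for x
  proof -
    show *: "(g x, x) \<in> G" using Gg[of "g x" x] X(2)[OF that] by simp
    then show "g x \<in> X" using \<open>G \<subseteq> V\<close> X(3) that V_sym by blast
    show "f (g x) = x" using * Gf[of "g x" x] by simp
  qed
  define \<phi> where "\<phi> x = (if x \<in> X then f x else x)" for x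
  define \<psi> where "\<psi> x = (if x \<in> X then g x else x)" for x
  have meas: "\<phi> \<in> M \<rightarrow>\<^sub>M M" "\<psi> \<in> M \<rightarrow>\<^sub>M M"
    unfolding \<phi>_def \<psi>_def using fg(3,4) by measurable
  have "distr M M \<phi> = M"
  proof (rule measure_eqI)
    fix C assume "C \<in> sets (distr M M \<phi>)"
    then have C [measurable]: "C \<in> sets M" by simp
    \<comment> \<open>Up to null sets this piece of \<open>G\<close> has the preimage of
      \<open>C\<close> under \<open>\<phi>\<close> as domain and \<open>C\<close> as range, so the
      two have the same measure.\<close>
    let ?K = "G \<inter> X \<times> C"
    have K: "partial_iso M ?K" by (rule partial_iso_restrict[OF G(1) X_sets C])
    have K_sets: "Domain ?K \<in> sets M" "Range ?K \<in> sets M" using partial_isoE[OF K] by metis+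
    have "emeasure (distr M M \<phi>) C = emeasure M (\<phi> -` C \<inter> space M)"
      using meas by (simp add: emeasure_distr)
    also have "\<dots> = emeasure M (Domain ?K)"
    proof (rule emeasure_eq_AE)
      show "\<phi> -` C \<inter> space M \<in> sets M" using meas by measurable
      show "AE x in M. x \<in> \<phi> -` C \<inter> space M \<longleftrightarrow> x \<in> Domain ?K"
        using X_AE
      proof eventually_elim
        case (elim x)
        have "x \<in> Domain ?K \<longleftrightarrow> f x \<in> C"
        proof
          assume "x \<in> Domain ?K"
          then obtain y where "(x, y) \<in> G" "y \<in> C" by blast
          moreover from this(1) have "y = f x" by (simp only: Gf)
          ultimately show "f x \<in> C" by simp
        qed (use fX(1)[OF elim] elim in blast)
        then show ?case using elim X_space unfolding \<phi>_def by auto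
      qed
    qed (rule K_sets)
    also have "\<dots> = emeasure M (Range ?K)"
      using \<open>G \<subseteq> V\<close> by (intro partial_iso_measure[OF K]) auto
    also have "\<dots> = emeasure M C"
    proof (rule emeasure_eq_AE)
      show "AE x in M. x \<in> Range ?K \<longleftrightarrow> x \<in> C"
        using X_AE
      proof eventually_elim
        case (elim x)
        have "(g x, x) \<in> ?K" if "x \<in> C" using gX(1,2)[OF elim] that by simp
        then show ?case by auto
      qed
    qed (use K_sets C in auto)
    finally show "emeasure (distr M M \<phi>) C = emeasure M C" .
  qed simp
  then have "\<phi> \<in> mp_maps M"
    using fX gX by (intro mp_mapsI[OF meas]) (auto simp: \<phi>_def \<psi>_def)
  moreover have "AE x in M. (x, \<phi> x) \<in> S"
    using X_AE by eventually_elim (use fX(1) G(3) in \<open>auto simp: \<phi>_def\<close>)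
  moreover have "AE x in M. x \<in> Domain G0 \<longrightarrow> (x, \<phi> x) \<in> G0"
    using X_AE
  proof eventually_elim
    case (elim x)
    show ?case
    proof
      assume "x \<in> Domain G0"
      then obtain y where y: "(x, y) \<in> G0" by auto
      then have "y = f x" using G(2) Gf by blast
      then show "(x, \<phi> x) \<in> G0" using y elim unfolding \<phi>_def by simp
    qed
  qed
  ultimately show thesis by (rule that)
qed

end

section \<open>Ergodic relations\<close>

locale ergodic_relation = pmp_relation +
  assumes V_ergodic: "ergodic_rel M V"
begin

text \<open>\<open>ergodic_rel\<close> speaks of sets that are exactly measurable and exactly
  invariant, whereas the sets that arise are so only almost everywhere. Intersecting with an
  invariant conull set repairs both defects.\<close>

lemma AE_zero_one:
  assumes A: "A \<in> sets M" "AE x in M. x \<in> E \<longleftrightarrow> x \<in> A"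
    and inv: "AE x in M. \<forall>y. (x, y) \<in> V \<longrightarrow> x \<in> E \<longrightarrow> y \<in> E"
  shows "(AE x in M. x \<in> E) \<or> (AE x in M. x \<notin> E)"
proof -
  have "AE x in M. (x \<in> E \<longleftrightarrow> x \<in> A) \<and> (\<forall>y. (x, y) \<in> V \<longrightarrow> x \<in> E \<longrightarrow> y \<in> E)"
    using A(2) inv by eventually_elim auto
  then obtain X where X: "X \<in> conull_sets M"
    "\<And>x. x \<in> X \<Longrightarrow> (x \<in> E \<longleftrightarrow> x \<in> A) \<and> (\<forall>y. (x, y) \<in> V \<longrightarrow> x \<in> E \<longrightarrow> y \<in> E)"
    "\<And>x y. x \<in> X \<Longrightarrow> (x, y) \<in> V \<Longrightarrow> y \<in> X"
    by (rule AE_invariant_conull) (rule that)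
  have AX: "A \<inter> X \<in> sets M" using A(1) conull_setsD(1)[OF X(1)] by auto
  have "V `` (A \<inter> X) \<subseteq> A \<inter> X" using X(2,3) by blast
  then have "emeasure M (A \<inter> X) = 0 \<or> emeasure M (A \<inter> X) = 1"
    using V_ergodic AX unfolding ergodic_rel_def by blast
  then show ?thesis
  proof
    assume "emeasure M (A \<inter> X) = 0"
    then have "AE x in M. x \<notin> A \<inter> X" using AX by (intro AE_not_in) auto
    with conull_set_AE[OF X(1)] A(2) have "AE x in M. x \<notin> E" by eventually_elim auto
    then show ?thesis ..
  next
    assume "emeasure M (A \<inter> X) = 1"
    then have "AE x in M. x \<in> A \<inter> X" 
      using AE_in_set_eq_1[OF AX] by (simp only: emeasure_eq_measure) simp
    with A(2) have "AE x in M. x \<in> E" by eventually_elim auto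
    then show ?thesis ..
  qed
qed

text \<open>The saturation of \<open>B\<close> is invariant, so it is null or conull, and it
  contains the non-null set \<open>B\<close>.\<close>

lemma AE_reaches:
  assumes B: "B \<in> sets M" "emeasure M B \<noteq> 0"
  shows "AE x in M. \<exists>y\<in>B. (x, y) \<in> V"
proof -
  let ?E = "Domain (V \<inter> space M \<times> B)"
  obtain A where A: "A \<in> sets M" "AE x in M. x \<in> ?E \<longleftrightarrow> x \<in> A"
    using Domain_AE_measurable[of "V \<inter> space M \<times> B"] B(1) by auto
  have "(AE x in M. x \<in> ?E) \<or> (AE x in M. x \<notin> ?E)"
  proof (rule AE_zero_one[OF A])
    show "AE x in M. \<forall>y. (x, y) \<in> V \<longrightarrow> x \<in> ?E \<longrightarrow> y \<in> ?E"
      by (intro AE_I2 allI impI) (use V_sym V_trans V_space in blast)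
  qed
  then show ?thesis
  proof
    assume "AE x in M. x \<in> ?E"
    then show ?thesis by eventually_elim auto
  next
    assume "AE x in M. x \<notin> ?E"
    with AE_space have "AE x in M. x \<notin> B"
    proof eventually_elim
      case (elim x)
      then show ?case using V_refl by auto
    qed
    then have False using not_AE_not_in[OF B] by simp
    then show ?thesis ..
  qed
qed

end

section \<open>Automorphism groups\<close>

text \<open>The coset equation becomes a test on single elements. The two directions of the test
  correspond to the two inclusions, neither of which implies the other in an infinite group.\<close>

lemma (in group) conj_coset_eq_iff:
  assumes H: "H \<subseteq> carrier G" and g: "g \<in> carrier G"
  shows "(g <# H) #> inv g = H \<longleftrightarrow> (\<forall>k\<in>carrier G. k \<in> H \<longleftrightarrow> g \<otimes> k \<otimes> inv g \<in> H)"
proof -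
  have eq: "(g <# H) #> inv g = (\<lambda>h. g \<otimes> h \<otimes> inv g) ` H"
    unfolding l_coset_def r_coset_def by auto
  have inj: "k = h" if "k \<in> carrier G" "h \<in> carrier G" "g \<otimes> k \<otimes> inv g = g \<otimes> h \<otimes> inv g" for k h
    using that g by (simp add: m_assoc)
  show ?thesis unfolding eq
  proof
    assume *: "(\<lambda>h. g \<otimes> h \<otimes> inv g) ` H = H"
    show "\<forall>k\<in>carrier G. k \<in> H \<longleftrightarrow> g \<otimes> k \<otimes> inv g \<in> H"
    proof (intro ballI iffI)
      fix k assume k: "k \<in> carrier G" "g \<otimes> k \<otimes> inv g \<in> H"
      then have "g \<otimes> k \<otimes> inv g \<in> (\<lambda>h. g \<otimes> h \<otimes> inv g) ` H" using * by simp
      then obtain h where "h \<in> H" "g \<otimes> k \<otimes> inv g = g \<otimes> h \<otimes> inv g" by auto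
      then show "k \<in> H" using inj[of k h] k H by auto
    qed (use * in blast)
  next
    assume *: "\<forall>k\<in>carrier G. k \<in> H \<longleftrightarrow> g \<otimes> k \<otimes> inv g \<in> H"
    show "(\<lambda>h. g \<otimes> h \<otimes> inv g) ` H = H"
    proof (intro equalityI subsetI)
      fix h assume h: "h \<in> H"
      let ?k = "inv g \<otimes> h \<otimes> g"
      have hc: "h \<in> carrier G" using h H by auto
      have "g \<otimes> ?k \<otimes> inv g = (g \<otimes> inv g) \<otimes> h \<otimes> (g \<otimes> inv g)"
        using g hc by (simp only: m_assoc inv_closed m_closed)
      also have "\<dots> = h" using g hc by simp
      finally have k: "g \<otimes> ?k \<otimes> inv g = h" .
      moreover have "?k \<in> carrier G" using g hc by simp
      ultimately have "?k \<in> H" using * h by metis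
      then show "h \<in> (\<lambda>h. g \<otimes> h \<otimes> inv g) ` H" by (rule rev_image_eqI) (simp only: k)
    qed (use * H in auto)
  qed
qed

section \<open>Automorphisms modulo null sets\<close>

abbreviation minv :: "'a measure \<Rightarrow> ('a \<Rightarrow> 'a) \<Rightarrow> 'a \<Rightarrow> 'a" where
  "minv M f \<equiv> the_inv_into (space M) f"

abbreviation ae_class :: "'a measure \<Rightarrow> ('a \<Rightarrow> 'a) \<Rightarrow> ('a \<Rightarrow> 'a) set" where
  "ae_class M f \<equiv> ae_eq M `` {f}"

lemma mp_maps_measurable: "f \<in> mp_maps M \<Longrightarrow> f \<in> M \<rightarrow>\<^sub>M M"
  and mp_maps_distr: "f \<in> mp_maps M \<Longrightarrow> distr M M f = M"
  unfolding mp_maps_def by auto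

lemma mp_maps_space: "f \<in> mp_maps M \<Longrightarrow> x \<in> space M \<Longrightarrow> f x \<in> space M"
  by (rule measurable_space[OF mp_maps_measurable])

lemma minv_left: "f \<in> mp_maps M \<Longrightarrow> x \<in> space M \<Longrightarrow> minv M f (f x) = x"
  unfolding mp_maps_def bij_betw_def by (auto intro: the_inv_into_f_f)

lemma minv_right: "f \<in> mp_maps M \<Longrightarrow> x \<in> space M \<Longrightarrow> f (minv M f x) = x"
  unfolding mp_maps_def bij_betw_def by (auto intro: f_the_inv_into_f)

lemma id_mp_maps: "id \<in> mp_maps M"
  by (rule mp_mapsI[of _ _ id]) (auto simp: id_def distr_id)

lemma comp_mp_maps:
  assumes f: "f \<in> mp_maps M" and g: "g \<in> mp_maps M"
  shows "f \<circ> g \<in> mp_maps M"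
proof (rule mp_mapsI[of _ _ "minv M g \<circ> minv M f"])
  show "f \<circ> g \<in> M \<rightarrow>\<^sub>M M" using f g mp_maps_measurable by (metis measurable_comp)
  show "minv M g \<circ> minv M f \<in> M \<rightarrow>\<^sub>M M" using f g unfolding mp_maps_def by (auto intro: measurable_comp)
  have [simp]: "minv M f x \<in> space M" if "x \<in> space M" for x
    using f that measurable_space[of "minv M f" M M] unfolding mp_maps_def by auto
  show "(minv M g \<circ> minv M f) ((f \<circ> g) x) = x" if "x \<in> space M" for x
    using that f g by (simp add: minv_left mp_maps_space)
  show "(f \<circ> g) ((minv M g \<circ> minv M f) x) = x" if "x \<in> space M" for x
    using that f g by (simp add: minv_right mp_maps_space)
  have "distr M M (f \<circ> g) = distr (distr M M g) M f"
    by (intro distr_distr[symmetric] mp_maps_measurable f g)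
  then show "distr M M (f \<circ> g) = M" using f g by (simp add: mp_maps_distr)
qed

lemma minv_mp_maps:
  assumes f: "f \<in> mp_maps M"
  shows "minv M f \<in> mp_maps M"
proof (rule mp_mapsI[of _ _ f])
  show *: "minv M f \<in> M \<rightarrow>\<^sub>M M" using f unfolding mp_maps_def by auto
  have "distr M M (minv M f) = distr (distr M M f) M (minv M f)" using f by (simp add: mp_maps_distr)
  also have "\<dots> = distr M M (minv M f \<circ> f)"
    by (intro distr_distr mp_maps_measurable f *)
  also have "\<dots> = distr M M (\<lambda>x. x)" using f by (intro distr_cong) (auto simp: minv_left)
  finally show "distr M M (minv M f) = M" by (simp add: distr_id)
qed (use f in \<open>auto simp: minv_left minv_right mp_maps_measurable\<close>)

lemma AE_comp:
  assumes f: "f \<in> mp_maps M" and "AE x in M. P x"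
  shows "AE x in M. P (f x)"
  by (rule AE_distrD[OF mp_maps_measurable[OF f]]) (unfold mp_maps_distr[OF f], fact)

lemma AE_comp_iff:
  assumes f: "f \<in> mp_maps M"
  shows "(AE x in M. P (f x)) \<longleftrightarrow> (AE x in M. P x)"
proof
  assume "AE x in M. P (f x)"
  from AE_comp[OF minv_mp_maps[OF f] this] AE_space show "AE x in M. P x"
    by eventually_elim (simp add: minv_right[OF f])
qed (rule AE_comp[OF f])

lemma ae_eq_equiv: "equiv (mp_maps M) (ae_eq M)"
proof (rule equivI)
  show "ae_eq M \<subseteq> mp_maps M \<times> mp_maps M" unfolding ae_eq_def by auto
  show "refl_on (mp_maps M) (ae_eq M)" unfolding ae_eq_def refl_on_def by auto
  show "sym (ae_eq M)" unfolding ae_eq_def sym_def by (auto simp: eq_commute)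
  show "trans (ae_eq M)" unfolding ae_eq_def by (auto intro!: transI elim: AE_mp)
qed

lemma ae_class_eq_iff:
  "f \<in> mp_maps M \<Longrightarrow> g \<in> mp_maps M \<Longrightarrow> ae_class M f = ae_class M g \<longleftrightarrow> (AE x in M. f x = g x)"
  using eq_equiv_class_iff[OF ae_eq_equiv, of f M g] by (simp add: ae_eq_def)

lemma Aut_carrier: "carrier (Aut M) = ae_class M ` mp_maps M"
  unfolding Aut_def quotient_def by auto

lemma Aut_carrierI: "f \<in> mp_maps M \<Longrightarrow> ae_class M f \<in> carrier (Aut M)"
  unfolding Aut_carrier by blast

lemma Aut_one: "\<one>\<^bsub>Aut M\<^esub> = ae_class M id"
  unfolding Aut_def by simp

text \<open>Independence of the representatives: changing \<open>f\<close> on a null set changes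
  \<open>f \<circ> g\<close> only on the preimage of that set under \<open>g\<close>, which is null
  because \<open>g\<close> preserves the measure.\<close>

lemma Aut_mult:
  assumes f: "f \<in> mp_maps M" and g: "g \<in> mp_maps M"
  shows "ae_class M f \<otimes>\<^bsub>Aut M\<^esub> ae_class M g = ae_class M (f \<circ> g)"
proof -
  have "ae_class M (f' \<circ> g') = ae_class M (f \<circ> g)"
    if "f' \<in> ae_class M f" "g' \<in> ae_class M g" for f' g'
  proof -
    have f': "f' \<in> mp_maps M" "AE x in M. f x = f' x" and g': "g' \<in> mp_maps M" "AE x in M. g x = g' x"
      using that by (auto simp: ae_eq_def)
    have "AE x in M. (f' \<circ> g') x = (f \<circ> g) x"
      using AE_comp[OF g f'(2)] g'(2) by eventually_elim simp
    then show ?thesis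
      using f f'(1) g g'(1) by (subst ae_class_eq_iff) (auto simp: comp_mp_maps)
  qed
  moreover have "f \<in> ae_class M f" "g \<in> ae_class M g" using f g by (auto simp: ae_eq_def)
  ultimately have "(\<Union>f'\<in>ae_class M f. \<Union>g'\<in>ae_class M g. ae_class M (f' \<circ> g')) = ae_class M (f \<circ> g)"
    by blast
  then show ?thesis unfolding Aut_def by simp
qed

lemma Aut_group: "group (Aut M)"
proof (rule groupI)
  fix x y assume "x \<in> carrier (Aut M)" "y \<in> carrier (Aut M)"
  then show "x \<otimes>\<^bsub>Aut M\<^esub> y \<in> carrier (Aut M)"
    unfolding Aut_carrier by (auto simp: Aut_mult comp_mp_maps)
next
  show "\<one>\<^bsub>Aut M\<^esub> \<in> carrier (Aut M)" unfolding Aut_carrier Aut_one by (simp add: id_mp_maps)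
next
  fix x y z assume "x \<in> carrier (Aut M)" "y \<in> carrier (Aut M)" "z \<in> carrier (Aut M)"
  then show "x \<otimes>\<^bsub>Aut M\<^esub> y \<otimes>\<^bsub>Aut M\<^esub> z = x \<otimes>\<^bsub>Aut M\<^esub> (y \<otimes>\<^bsub>Aut M\<^esub> z)"
    unfolding Aut_carrier by (auto simp: Aut_mult comp_mp_maps comp_assoc)
next
  fix x assume "x \<in> carrier (Aut M)"
  then obtain f where f: "f \<in> mp_maps M" "x = ae_class M f" unfolding Aut_carrier by auto
  show "\<one>\<^bsub>Aut M\<^esub> \<otimes>\<^bsub>Aut M\<^esub> x = x"
    unfolding Aut_one f(2) by (simp add: Aut_mult id_mp_maps f(1))
  have "ae_class M (minv M f) \<otimes>\<^bsub>Aut M\<^esub> x = \<one>\<^bsub>Aut M\<^esub>"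
    unfolding Aut_one f(2) Aut_mult[OF minv_mp_maps[OF f(1)] f(1)]
    by (subst ae_class_eq_iff) (auto simp: comp_mp_maps minv_mp_maps f(1) id_mp_maps minv_left)
  then show "\<exists>y\<in>carrier (Aut M). y \<otimes>\<^bsub>Aut M\<^esub> x = \<one>\<^bsub>Aut M\<^esub>"
    using Aut_carrierI[OF minv_mp_maps[OF f(1)]] by blast
qed

lemma Aut_inv:
  assumes f: "f \<in> mp_maps M"
  shows "inv\<^bsub>Aut M\<^esub> (ae_class M f) = ae_class M (minv M f)"
proof (rule group.inv_equality[OF Aut_group])
  show "ae_class M (minv M f) \<otimes>\<^bsub>Aut M\<^esub> ae_class M f = \<one>\<^bsub>Aut M\<^esub>"
    unfolding Aut_one Aut_mult[OF minv_mp_maps[OF f] f]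
    by (subst ae_class_eq_iff) (auto simp: comp_mp_maps minv_mp_maps f id_mp_maps minv_left)
qed (simp_all add: Aut_carrierI f minv_mp_maps)

text \<open>The definition asks for some representative; removing from the conull set the points
  where two representatives differ shows that any one will do.\<close>

lemma Aut_rel_iff:
  assumes f: "f \<in> mp_maps M"
  shows "ae_class M f \<in> Aut_rel M R \<longleftrightarrow>
    (\<exists>X\<in>conull_sets M. \<forall>x\<in>X. \<forall>y\<in>X. (x, y) \<in> R \<longleftrightarrow> (f x, f y) \<in> R)"
proof
  assume "\<exists>X\<in>conull_sets M. \<forall>x\<in>X. \<forall>y\<in>X. (x, y) \<in> R \<longleftrightarrow> (f x, f y) \<in> R"
  then have "rel_ae_eq M R {(x, y). (f x, f y) \<in> R}"
    unfolding rel_ae_eq_def by blast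
  moreover have "f \<in> ae_class M f" using f by (auto simp: ae_eq_def)
  ultimately show "ae_class M f \<in> Aut_rel M R"
    using Aut_carrierI[OF f] unfolding Aut_rel_def by blast
next
  assume "ae_class M f \<in> Aut_rel M R"
  then obtain g where g: "g \<in> ae_class M f" "rel_ae_eq M R {(x, y). (g x, g y) \<in> R}"
    unfolding Aut_rel_def by blast
  then obtain X where X: "X \<in> conull_sets M" "R \<inter> X \<times> X = {(x, y). (g x, g y) \<in> R} \<inter> X \<times> X"
    unfolding rel_ae_eq_def by blast
  have "AE x in M. f x = g x" using g(1) by (simp add: ae_eq_def)
  with conull_set_AE[OF X(1)] have "AE x in M. x \<in> X \<and> f x = g x" by eventually_elim simp
  then obtain Y where Y: "Y \<in> conull_sets M" "\<And>x. x \<in> Y \<Longrightarrow> x \<in> X \<and> f x = g x"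
    by (rule AE_conull_set) (rule that)
  have "(x, y) \<in> R \<longleftrightarrow> (f x, f y) \<in> R" if "x \<in> Y" "y \<in> Y" for x y
  proof -
    have "(x, y) \<in> R \<inter> X \<times> X \<longleftrightarrow> (x, y) \<in> {(x, y). (g x, g y) \<in> R} \<inter> X \<times> X" using X(2) by simp
    then show ?thesis using Y(2)[OF that(1)] Y(2)[OF that(2)] by simp
  qed
  then show "\<exists>X\<in>conull_sets M. \<forall>x\<in>X. \<forall>y\<in>X. (x, y) \<in> R \<longleftrightarrow> (f x, f y) \<in> R"
    using Y(1) by blast
qed

section \<open>Full groups\<close>

context pmp_relation
begin

text \<open>A map that moves points within their classes preserves the relation by symmetry and
  transitivity, so membership in \<open>Aut_rel\<close> is automatic.\<close>

lemma full_group_iff: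
  assumes f: "f \<in> mp_maps M"
  shows "ae_class M f \<in> full_group M V \<longleftrightarrow> (AE x in M. (x, f x) \<in> V)"
proof
  assume "ae_class M f \<in> full_group M V"
  then obtain g where "AE x in M. f x = g x" "AE x in M. (x, g x) \<in> V"
    unfolding full_group_def by (auto simp: ae_eq_def)
  then show "AE x in M. (x, f x) \<in> V" by eventually_elim simp
next
  assume AE: "AE x in M. (x, f x) \<in> V"
  then obtain X where X: "X \<in> conull_sets M" "\<And>x. x \<in> X \<Longrightarrow> (x, f x) \<in> V"
    by (rule AE_conull_set) (rule that)
  have "\<forall>x\<in>X. \<forall>y\<in>X. (x, y) \<in> V \<longleftrightarrow> (f x, f y) \<in> V"
    using X(2) V_sym V_trans by meson
  then have "ae_class M f \<in> Aut_rel M V" using X(1) Aut_rel_iff[OF f] by blast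
  moreover have "f \<in> ae_class M f" using f by (auto simp: ae_eq_def)
  ultimately show "ae_class M f \<in> full_group M V" using AE unfolding full_group_def by blast
qed

end

lemma full_group_carrier: "full_group M R \<subseteq> carrier (Aut M)"
  unfolding full_group_def Aut_rel_def by auto

context ergodic_relation
begin

text \<open>If \<open>f\<close> fails to preserve the relation, then a partial isomorphism inside the set of bad pairs
  extends to an element of the full group that \<open>f\<close> conjugates out of the full group.\<close>

lemma preserves_if_conjugates:
  assumes f [measurable]: "f \<in> M \<rightarrow>\<^sub>M M"
    and conj: "\<And>k. k \<in> mp_maps M \<Longrightarrow> AE x in M. (x, k x) \<in> V \<Longrightarrow> AE x in M. (f x, f (k x)) \<in> V"
  shows "AE x in M. \<forall>y. (x, y) \<in> V \<longrightarrow> (f x, f y) \<in> V"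
proof -
  define S where "S = {p \<in> space (M \<Otimes>\<^sub>M M). p \<in> V \<and> (f (fst p), f (snd p)) \<notin> V}"
  have S: "S \<in> sets (M \<Otimes>\<^sub>M M)" "S \<subseteq> V" unfolding S_def by (measurable, auto)
  have "AE x in M. x \<notin> Domain S"
  proof (rule ccontr)
    assume "\<not> (AE x in M. x \<notin> Domain S)"
    then obtain G where G: "partial_iso M G" "G \<subseteq> S" "emeasure M (Domain G) \<noteq> 0"
      by (rule positive_partial_iso[OF S]) (rule that)
    \<comment> \<open>The extension agrees with \<open>G\<close> on its domain and so moves these
      points along bad pairs. The assumption \<open>conj\<close> forbids this almost everywhere,
      which makes the domain null.\<close>
    obtain k where k: "k \<in> mp_maps M" "AE x in M. (x, k x) \<in> V" "AE x in M. x \<in> Domain G \<longrightarrow> (x, k x) \<in> G"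
      by (rule partial_iso_extends[OF V_sets order_refl G(1) order_trans[OF G(2) S(2)] AE_reaches]) (assumption, assumption, rule that)
    from conj[OF k(1,2)] k(3) have "AE x in M. x \<notin> Domain G"
      by eventually_elim (use G(2) in \<open>auto simp: S_def\<close>)
    moreover have "Domain G \<in> sets M" by (rule partial_isoE[OF G(1)])
    ultimately show False using not_AE_not_in G(3) by blast
  qed
  then show ?thesis
    by eventually_elim (auto simp: S_def space_pair_measure Domain_iff dest: V_space)
qed

text \<open>After substituting \<open>f x\<close> for \<open>x\<close>, the conjugate of
  \<open>k\<close> by \<open>f\<close> lies in the full group iff \<open>f x\<close> and
  \<open>f (k x)\<close> are related almost everywhere. The two halves of the elementwise test then
  show that \<open>f\<close> and its inverse preserve the relation.\<close>

theorem normalizes_full_group_iff: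
  assumes A: "A \<in> carrier (Aut M)"
  shows "(A <#\<^bsub>Aut M\<^esub> full_group M V) #>\<^bsub>Aut M\<^esub> inv\<^bsub>Aut M\<^esub> A = full_group M V
    \<longleftrightarrow> A \<in> Aut_rel M V"
proof -
  obtain f where f: "f \<in> mp_maps M" and Af: "A = ae_class M f" using A unfolding Aut_carrier by auto
  note fi = minv_mp_maps[OF f]
  have conj_mem: "ae_class M f \<otimes>\<^bsub>Aut M\<^esub> ae_class M k \<otimes>\<^bsub>Aut M\<^esub> inv\<^bsub>Aut M\<^esub> (ae_class M f) \<in> full_group M V
      \<longleftrightarrow> (AE x in M. (f x, f (k x)) \<in> V)" if k: "k \<in> mp_maps M" for k
  proof -
    have "ae_class M f \<otimes>\<^bsub>Aut M\<^esub> ae_class M k \<otimes>\<^bsub>Aut M\<^esub> inv\<^bsub>Aut M\<^esub> (ae_class M f) \<in> full_group M V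
        \<longleftrightarrow> (AE x in M. (x, (f \<circ> k \<circ> minv M f) x) \<in> V)"
      by (simp only: Aut_inv f k fi Aut_mult comp_mp_maps full_group_iff)
    also have "\<dots> \<longleftrightarrow> (AE x in M. (f x, (f \<circ> k \<circ> minv M f) (f x)) \<in> V)"
      by (rule AE_comp_iff[OF f, symmetric])
    also have "\<dots> \<longleftrightarrow> (AE x in M. (f x, f (k x)) \<in> V)"
      by (rule AE_cong) (simp add: minv_left[OF f])
    finally show ?thesis .
  qed
  have iff: "(A <#\<^bsub>Aut M\<^esub> full_group M V) #>\<^bsub>Aut M\<^esub> inv\<^bsub>Aut M\<^esub> A = full_group M V \<longleftrightarrow>
    (\<forall>k\<in>mp_maps M. (AE x in M. (x, k x) \<in> V) \<longleftrightarrow> (AE x in M. (f x, f (k x)) \<in> V))"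
    unfolding group.conj_coset_eq_iff[OF Aut_group full_group_carrier A] unfolding Af Aut_carrier
    using conj_mem full_group_iff by auto
  show ?thesis unfolding iff
  proof
    assume *: "\<forall>k\<in>mp_maps M. (AE x in M. (x, k x) \<in> V) \<longleftrightarrow> (AE x in M. (f x, f (k x)) \<in> V)"
    have 1: "AE x in M. \<forall>y. (x, y) \<in> V \<longrightarrow> (f x, f y) \<in> V"
      using * by (intro preserves_if_conjugates mp_maps_measurable f) blast
    \<comment> \<open>The inverse satisfies the same hypothesis: conjugating
      \<open>minv M f \<circ> k \<circ> f\<close> by \<open>f\<close> returns \<open>k\<close>, so
      the backward half of the test applies.\<close>
    have "AE x in M. \<forall>y. (x, y) \<in> V \<longrightarrow> (minv M f x, minv M f y) \<in> V"
    proof (intro preserves_if_conjugates mp_maps_measurable fi)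
      fix k assume k: "k \<in> mp_maps M" "AE x in M. (x, k x) \<in> V"
      have "AE x in M. (f x, f ((minv M f \<circ> k \<circ> f) x)) \<in> V"
        using AE_comp[OF f k(2)] AE_space
        by eventually_elim (simp add: minv_right f mp_maps_space k(1))
      then have "AE x in M. (x, (minv M f \<circ> k \<circ> f) x) \<in> V"
        using * k(1) f fi comp_mp_maps by blast
      from AE_comp[OF fi this] AE_space show "AE x in M. (minv M f x, minv M f (k x)) \<in> V"
        by eventually_elim (simp add: minv_right f)
    qed
    from AE_comp[OF f this] 1
    have "AE x in M. \<forall>y\<in>space M. (x, y) \<in> V \<longleftrightarrow> (f x, f y) \<in> V"
      using AE_space
    proof eventually_elim
      case (elim x)
      show ?case
      proof (intro ballI iffI)
        fix y assume "y \<in> space M" "(f x, f y) \<in> V"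
        then show "(x, y) \<in> V" using elim(1,3) minv_left[OF f] by metis
      qed (use elim in blast)
    qed
    then obtain X where X: "X \<in> conull_sets M" "\<And>x. x \<in> X \<Longrightarrow> \<forall>y\<in>space M. (x, y) \<in> V \<longleftrightarrow> (f x, f y) \<in> V"
      by (rule AE_conull_set) (rule that)
    show "A \<in> Aut_rel M V" unfolding Af Aut_rel_iff[OF f]
      using X conull_setsD(2)[OF X(1)] by blast
  next
    assume "A \<in> Aut_rel M V"
    then obtain X where X: "X \<in> conull_sets M" "\<forall>x\<in>X. \<forall>y\<in>X. (x, y) \<in> V \<longleftrightarrow> (f x, f y) \<in> V"
      unfolding Af Aut_rel_iff[OF f] by blast
    show "\<forall>k\<in>mp_maps M. (AE x in M. (x, k x) \<in> V) \<longleftrightarrow> (AE x in M. (f x, f (k x)) \<in> V)"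
    proof
      fix k assume k: "k \<in> mp_maps M"
      have "AE x in M. (x, k x) \<in> V \<longleftrightarrow> (f x, f (k x)) \<in> V"
        using conull_set_AE[OF X(1)] AE_comp[OF k conull_set_AE[OF X(1)]]
        by eventually_elim (use X(2) in blast)
      then show "(AE x in M. (x, k x) \<in> V) \<longleftrightarrow> (AE x in M. (f x, f (k x)) \<in> V)"
        by (rule eventually_subst)
    qed
  qed
qed

end

section \<open>The degree of an element of the normalizer\<close>

text \<open>Almost every point has its whole class inside the conull set where \<open>A\<close> and
  \<open>B\<close> agree, so agreement on a square becomes agreement along classes.\<close>

lemma (in pmp_relation) rel_ae_eqD:
  assumes "rel_ae_eq M A B"
  shows "AE x in M. \<forall>y. (x, y) \<in> V \<longrightarrow> ((x, y) \<in> A \<longleftrightarrow> (x, y) \<in> B)"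
proof -
  obtain X where X: "X \<in> conull_sets M" "A \<inter> X \<times> X = B \<inter> X \<times> X"
    using assms unfolding rel_ae_eq_def by blast
  show ?thesis
    using conull_set_AE[OF X(1)] AE_saturate[OF conull_set_AE[OF X(1)]]
    by eventually_elim (use X(2) in blast)
qed

locale ergodic_pair = R: ergodic_relation M R + U: ergodic_relation M U
  for M :: "'a measure" and R U +
  assumes R_le_U: "rel_ae_le M R U"
begin

lemma AE_R_U: "AE x in M. \<forall>y. (x, y) \<in> R \<longrightarrow> (x, y) \<in> U"
proof -
  obtain X where X: "X \<in> conull_sets M" "R \<inter> X \<times> X \<subseteq> U \<inter> X \<times> X"
    using R_le_U unfolding rel_ae_le_def by blast
  show ?thesis
    using conull_set_AE[OF X(1)] R.AE_saturate[OF conull_set_AE[OF X(1)]]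
    by eventually_elim (use X(2) in blast)
qed

lemma full_normalizer_eq: "full_normalizer M U R = full_group M U \<inter> Aut_rel M R"
  using R.normalizes_full_group_iff full_group_carrier[of M U]
  unfolding full_normalizer_def by blast

lemma full_normalizer_iff:
  assumes "f \<in> mp_maps M"
  shows "ae_class M f \<in> full_normalizer M U R \<longleftrightarrow> (AE x in M. (x, f x) \<in> U) \<and> ae_class M f \<in> Aut_rel M R"
  unfolding full_normalizer_eq using U.full_group_iff[OF assms] by auto

end

locale quotient_cocycle = ergodic_pair M R U + Q: group Q
  for M :: "'a measure" and R U and Q :: "('q, 'z) monoid_scheme" (structure) +
  fixes \<theta> :: "'a \<times> 'a \<Rightarrow> 'q"
  assumes Q_countable: "countable (carrier Q)"
    and \<theta>_measurable: "\<theta> \<in> restrict_space (M \<Otimes>\<^sub>M M) U \<rightarrow>\<^sub>M count_space (carrier Q)"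
    and \<theta>_mult: "(x, y) \<in> U \<Longrightarrow> (y, z) \<in> U \<Longrightarrow> \<theta> (x, y) \<otimes> \<theta> (y, z) = \<theta> (x, z)"
    and \<theta>_kernel: "rel_ae_eq M R {p \<in> U. \<theta> p = \<one>}"
    and \<theta>_onto: "AE x in M. \<forall>h\<in>carrier Q. \<exists>y. (y, x) \<in> U \<and> \<theta> (y, x) = h"
begin

lemma \<theta>_carrier: "(x, y) \<in> U \<Longrightarrow> \<theta> (x, y) \<in> carrier Q"
  using measurable_space[OF \<theta>_measurable, of "(x, y)"] U.V_space
  by (simp add: space_restrict_space space_pair_measure)

lemma \<theta>_refl:
  assumes "x \<in> space M"
  shows "\<theta> (x, x) = \<one>"
  using \<theta>_mult[of x x x] \<theta>_carrier[of x x] U.V_refl[OF assms] by simp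

lemma \<theta>_swap:
  assumes "(x, y) \<in> U"
  shows "\<theta> (y, x) = inv \<theta> (x, y)"
proof (rule Q.inv_equality[symmetric])
  show "\<theta> (y, x) \<otimes> \<theta> (x, y) = \<one>"
    using \<theta>_mult[OF U.V_sym[OF assms] assms] \<theta>_refl U.V_space[OF assms] by simp
qed (use assms U.V_sym \<theta>_carrier in auto)

lemma \<theta>_fiber_sets: "{p \<in> U. \<theta> p = h} \<in> sets (M \<Otimes>\<^sub>M M)"
proof (cases "h \<in> carrier Q")
  case True
  have sp: "space (restrict_space (M \<Otimes>\<^sub>M M) U) = U"
    using sets.sets_into_space[OF U.V_sets] by (auto simp: space_restrict_space)
  have "\<theta> -` {h} \<inter> space (restrict_space (M \<Otimes>\<^sub>M M) U) \<in> sets (restrict_space (M \<Otimes>\<^sub>M M) U)"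
    using True by (intro measurable_sets[OF \<theta>_measurable]) auto
  then have "\<theta> -` {h} \<inter> U \<in> sets (M \<Otimes>\<^sub>M M)"
    unfolding sp using U.V_sets by (subst (asm) sets_restrict_space_iff) (auto intro: sets.Int)
  also have "\<theta> -` {h} \<inter> U = {p \<in> U. \<theta> p = h}" by auto
  finally show ?thesis .
next
  case False
  then have "{p \<in> U. \<theta> p = h} = {}" using \<theta>_carrier by force
  then show ?thesis by (simp only: sets.empty_sets)
qed

lemma AE_R_kernel: "AE x in M. \<forall>y. (x, y) \<in> R \<longrightarrow> (x, y) \<in> U \<and> \<theta> (x, y) = \<one>"
  using R.rel_ae_eqD[OF \<theta>_kernel] by eventually_elim auto

lemma AE_U_kernel: "AE x in M. \<forall>y. (x, y) \<in> U \<longrightarrow> ((x, y) \<in> R \<longleftrightarrow> \<theta> (x, y) = \<one>)"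
  using U.rel_ae_eqD[OF \<theta>_kernel] by eventually_elim auto

text \<open>A relation and not a function, because a map in the full group of \<open>U\<close> need
  not have a constant value. The maps that have one turn out to be the representatives of the
  normalizer.\<close>

definition degree :: "('a \<Rightarrow> 'a) \<Rightarrow> 'q \<Rightarrow> bool" where
  "degree f h \<longleftrightarrow> f \<in> mp_maps M \<and> h \<in> carrier Q \<and> (AE x in M. (x, f x) \<in> U \<and> \<theta> (f x, x) = h)"

lemma degree_unique:
  assumes "degree f h" "degree g k" "AE x in M. f x = g x"
  shows "h = k"
proof -
  have "AE x in M. \<theta> (f x, x) = h" "AE x in M. \<theta> (g x, x) = k" using assms unfolding degree_def by auto
  with assms(3) have "AE x in M. h = k" by eventually_elim simp
  then show ?thesis by simp
qed

lemma degree_comp: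
  assumes f: "degree f h" and g: "degree g k"
  shows "degree (f \<circ> g) (h \<otimes> k)"
proof -
  have f': "f \<in> mp_maps M" "h \<in> carrier Q" "AE x in M. (x, f x) \<in> U \<and> \<theta> (f x, x) = h"
    and g': "g \<in> mp_maps M" "k \<in> carrier Q" "AE x in M. (x, g x) \<in> U \<and> \<theta> (g x, x) = k"
    using f g unfolding degree_def by auto
  have "AE x in M. (x, (f \<circ> g) x) \<in> U \<and> \<theta> ((f \<circ> g) x, x) = h \<otimes> k"
    using AE_comp[OF g'(1) f'(3)] g'(3)
  proof eventually_elim
    case (elim x)
    then show ?case using \<theta>_mult[of "f (g x)" "g x" x] U.V_sym U.V_trans[of x "g x" "f (g x)"] by auto
  qed
  then show ?thesis using f' g' unfolding degree_def by (auto simp: comp_mp_maps)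
qed

lemma degree_minv:
  assumes f: "degree f h"
  shows "degree (minv M f) (inv h)"
proof -
  have f': "f \<in> mp_maps M" "h \<in> carrier Q" "AE x in M. (x, f x) \<in> U \<and> \<theta> (f x, x) = h"
    using f unfolding degree_def by auto
  have "AE x in M. (x, minv M f x) \<in> U \<and> \<theta> (minv M f x, x) = inv h"
    using AE_comp[OF minv_mp_maps[OF f'(1)] f'(3)] AE_space
  proof eventually_elim
    case (elim x)
    then have "(minv M f x, x) \<in> U" "\<theta> (x, minv M f x) = h" using minv_right[OF f'(1)] by auto
    then show ?case using U.V_sym \<theta>_swap by blast
  qed
  then show ?thesis using f' unfolding degree_def by (auto simp: minv_mp_maps)
qed

text \<open>Going from \<open>f x\<close> to \<open>f y\<close> through \<open>x\<close> and
  \<open>y\<close> shows that \<open>\<theta> (f x, f y)\<close> is the conjugate of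
  \<open>\<theta> (x, y)\<close> by \<open>h\<close>; the value \<open>h\<close> must be the same at
  both points. Hence \<open>f\<close> preserves the kernel.\<close>

lemma degree_Aut_rel:
  assumes f: "degree f h"
  shows "ae_class M f \<in> Aut_rel M R"
proof -
  have f': "f \<in> mp_maps M" "h \<in> carrier Q" "AE x in M. (x, f x) \<in> U \<and> \<theta> (f x, x) = h"
    using f unfolding degree_def by auto
  have "AE x in M. ((x, f x) \<in> U \<and> \<theta> (f x, x) = h) \<and> (\<forall>y. (x, y) \<in> R \<longleftrightarrow> (x, y) \<in> U \<and> \<theta> (x, y) = \<one>)"
    using f'(3) AE_R_kernel AE_U_kernel by eventually_elim blast
  then obtain X where X: "X \<in> conull_sets M"
    "\<And>x. x \<in> X \<Longrightarrow> ((x, f x) \<in> U \<and> \<theta> (f x, x) = h) \<and> (\<forall>y. (x, y) \<in> R \<longleftrightarrow> (x, y) \<in> U \<and> \<theta> (x, y) = \<one>)"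
    "\<And>x y. x \<in> X \<Longrightarrow> (x, y) \<in> U \<Longrightarrow> y \<in> X"
    by (rule U.AE_invariant_conull) (rule that)
  have "(x, y) \<in> R \<longleftrightarrow> (f x, f y) \<in> R" if "x \<in> X" "y \<in> X" for x y
  proof -
    have xf: "(x, f x) \<in> U" "(f x, x) \<in> U" "\<theta> (f x, x) = h" and yf: "(y, f y) \<in> U" "(f y, y) \<in> U" "\<theta> (f y, y) = h"
      using X(2) that U.V_sym by auto
    have R_iff: "(x, y) \<in> R \<longleftrightarrow> (x, y) \<in> U \<and> \<theta> (x, y) = \<one>"
      "(f x, f y) \<in> R \<longleftrightarrow> (f x, f y) \<in> U \<and> \<theta> (f x, f y) = \<one>"
      using X(2)[OF that(1)] X(2)[OF X(3)[OF that(1) xf(1)]] by auto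
    have U_iff: "(x, y) \<in> U \<longleftrightarrow> (f x, f y) \<in> U"
      using xf yf U.V_trans by meson
    have "\<theta> (x, y) = \<one> \<longleftrightarrow> \<theta> (f x, f y) = \<one>" if xy: "(x, y) \<in> U"
    proof -
      have c: "\<theta> (x, y) \<in> carrier Q" using \<theta>_carrier xy by blast
      have "\<theta> (f x, f y) = \<theta> (f x, y) \<otimes> \<theta> (y, f y)"
        using U.V_trans[OF xf(2) xy] yf(1) by (rule \<theta>_mult[symmetric])
      also have "\<theta> (f x, y) = h \<otimes> \<theta> (x, y)" using \<theta>_mult[OF xf(2) xy] xf(3) by simp
      also have "\<theta> (y, f y) = inv h" using \<theta>_swap[OF yf(2)] yf(3) by simp
      finally have eq: "\<theta> (f x, f y) = h \<otimes> \<theta> (x, y) \<otimes> inv h" .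
      show ?thesis
      proof
        assume "\<theta> (f x, f y) = \<one>"
        then have "h \<otimes> \<theta> (x, y) = h"
          using eq c f'(2) by (metis Q.inv_closed Q.inv_equality Q.inv_inv Q.m_closed)
        then show "\<theta> (x, y) = \<one>" using c f'(2) by simp
      qed (use eq f'(2) in simp)
    qed
    then show ?thesis using R_iff U_iff by blast
  qed
  then show ?thesis unfolding Aut_rel_iff[OF f'(1)] using X(1) by blast
qed

text \<open>The function \<open>\<lambda>x. \<theta> (f x, x)\<close> is invariant under \<open>R\<close>, hence constant by ergodicity.\<close>

lemma degree_exists:
  assumes f: "f \<in> mp_maps M" and fU: "AE x in M. (x, f x) \<in> U" and fR: "ae_class M f \<in> Aut_rel M R"
  shows "\<exists>h. degree f h"
proof -
  define E where "E h = {x. (f x, x) \<in> {p \<in> U. \<theta> p = h}}" for h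
  obtain X where X: "X \<in> conull_sets M" "\<forall>x\<in>X. \<forall>y\<in>X. (x, y) \<in> R \<longleftrightarrow> (f x, f y) \<in> R"
    using fR unfolding Aut_rel_iff[OF f] by blast
  have pres: "AE x in M. \<forall>y. (x, y) \<in> R \<longrightarrow> (f x, f y) \<in> R"
    using conull_set_AE[OF X(1)] R.AE_saturate[OF conull_set_AE[OF X(1)]]
    by eventually_elim (use X(2) in blast)
  have zero_one: "(AE x in M. x \<in> E h) \<or> (AE x in M. x \<notin> E h)" for h
  proof (rule R.AE_zero_one)
    have [measurable]: "f \<in> M \<rightarrow>\<^sub>M M" by (rule mp_maps_measurable[OF f])
    have [measurable]: "{p \<in> U. \<theta> p = h} \<in> sets (M \<Otimes>\<^sub>M M)" by (rule \<theta>_fiber_sets)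
    show "{x \<in> space M. (f x, x) \<in> {p \<in> U. \<theta> p = h}} \<in> sets M" by measurable
    show "AE x in M. x \<in> E h \<longleftrightarrow> x \<in> {x \<in> space M. (f x, x) \<in> {p \<in> U. \<theta> p = h}}"
      by (rule AE_I2) (simp add: E_def)
    show "AE x in M. \<forall>y. (x, y) \<in> R \<longrightarrow> x \<in> E h \<longrightarrow> y \<in> E h"
      using pres AE_R_kernel AE_comp[OF f AE_R_kernel] R.AE_saturate[OF fU] fU
    proof eventually_elim
      case (elim x)
      show ?case
      proof (intro allI impI)
        fix y assume xy: "(x, y) \<in> R" and "x \<in> E h"
        then have x: "(f x, x) \<in> U" "\<theta> (f x, x) = h" unfolding E_def by auto
        have xyU: "(x, y) \<in> U" "\<theta> (x, y) = \<one>" using elim(2) xy by auto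
        have "(f x, f y) \<in> R" using elim(1) xy by auto
        then have fxy: "(f x, f y) \<in> U" "\<theta> (f x, f y) = \<one>" using elim(3) by auto
        have y: "(f y, y) \<in> U" using elim(4) xy U.V_sym by blast
        \<comment> \<open>The value at \<open>(f x, y)\<close> is computed through
          \<open>f y\<close> and through \<open>x\<close>; the pairs \<open>(f x, f y)\<close> and
          \<open>(x, y)\<close> lie in the kernel.\<close>
        have "\<theta> (f y, y) = \<theta> (f x, f y) \<otimes> \<theta> (f y, y)" using fxy \<theta>_carrier[OF y] by simp
        also have "\<dots> = \<theta> (f x, x) \<otimes> \<theta> (x, y)"
          using \<theta>_mult[OF fxy(1) y] \<theta>_mult[OF x(1) xyU(1)] by simp
        also have "\<dots> = h" using x xyU(2) \<theta>_carrier[OF x(1)] by simp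
        finally show "y \<in> E h" using y unfolding E_def by simp
      qed
    qed
  qed
  \<comment> \<open>By countability of \<open>Q\<close>, if each value occurred almost nowhere, then
    almost surely \<open>\<theta> (f x, x)\<close> would be no element of \<open>Q\<close>.\<close>
  have "\<exists>h\<in>carrier Q. AE x in M. x \<in> E h"
  proof (rule ccontr)
    assume "\<not> ?thesis"
    then have "\<forall>h\<in>carrier Q. AE x in M. x \<notin> E h" using zero_one by blast
    then have "AE x in M. \<forall>h\<in>carrier Q. x \<notin> E h" using Q_countable by (simp add: AE_ball_countable)
    with fU have "AE x in M. False"
      by eventually_elim (use \<theta>_carrier U.V_sym in \<open>auto simp: E_def\<close>)
    then show False by simp
  qed
  then obtain h where h: "h \<in> carrier Q" "AE x in M. x \<in> E h" by blast
  have "AE x in M. (x, f x) \<in> U \<and> \<theta> (f x, x) = h"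
    using h(2) fU by eventually_elim (auto simp: E_def)
  then show ?thesis using f h(1) unfolding degree_def by blast
qed

text \<open>The empty partial isomorphism is extended inside the fiber of \<open>\<theta>\<close>
  over \<open>h\<close>, with coordinates exchanged because the degree is read at
  \<open>(f x, x)\<close>.\<close>

lemma degree_onto:
  assumes h: "h \<in> carrier Q"
  shows "\<exists>f. degree f h"
proof -
  define S where "S = {p \<in> space (M \<Otimes>\<^sub>M M). (snd p, fst p) \<in> {p \<in> U. \<theta> p = h}}"
  have [measurable]: "{p \<in> U. \<theta> p = h} \<in> sets (M \<Otimes>\<^sub>M M)" by (rule \<theta>_fiber_sets)
  have S: "S \<in> sets (M \<Otimes>\<^sub>M M)" unfolding S_def by measurable
  have S_iff: "(x, y) \<in> S \<longleftrightarrow> (y, x) \<in> U \<and> \<theta> (y, x) = h" for x y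
    using U.V_space unfolding S_def by (auto simp: space_pair_measure)
  have "S \<subseteq> U" using U.V_sym S_iff by auto
  have empty: "partial_iso M {}" by (rule partial_isoI[of "{}" _ "{}" id id]) auto
  \<comment> \<open>Some \<open>y\<close> has \<open>\<theta> (y, x) = h\<close>, and ergodicity of
    \<open>R\<close> leads from \<open>y\<close> to a point \<open>z\<close> of \<open>B\<close> in
    its \<open>R\<close>-class. The second move has value one, so
    \<open>\<theta> (z, x) = h\<close>.\<close>
  have reach: "AE x in M. \<exists>y\<in>B. (x, y) \<in> S" if B: "B \<in> sets M" "emeasure M B \<noteq> 0" for B
  proof -
    have "AE x in M. \<exists>y\<in>B. (x, y) \<in> U \<and> \<theta> (x, y) = \<one>"
      using R.AE_reaches[OF B] AE_R_kernel by eventually_elim blast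
    from \<theta>_onto U.AE_saturate[OF this] show ?thesis
    proof eventually_elim
      case (elim x)
      then obtain y where y: "(y, x) \<in> U" "\<theta> (y, x) = h" using h by blast
      then obtain z where z: "z \<in> B" "(y, z) \<in> U" "\<theta> (y, z) = \<one>" using elim(2) U.V_sym by blast
      have zy: "(z, y) \<in> U" "\<theta> (z, y) = \<one>" using z U.V_sym \<theta>_swap[OF z(2)] by auto
      have "(z, x) \<in> U" using zy(1) y(1) U.V_trans by blast
      moreover have "\<theta> (z, x) = h" using \<theta>_mult[OF zy(1) y(1)] zy(2) y(2) h by simp
      ultimately show ?case using z(1) S_iff by blast
    qed
  qed
  obtain f where f: "f \<in> mp_maps M" "AE x in M. (x, f x) \<in> S"
    by (rule U.partial_iso_extends[OF S \<open>S \<subseteq> U\<close> empty _ reach]) (auto intro: that)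
  have "AE x in M. (x, f x) \<in> U \<and> \<theta> (f x, x) = h"
    using f(2) by eventually_elim (use S_iff U.V_sym in blast)
  then show ?thesis using f(1) h unfolding degree_def by blast
qed

lemma degree_one_iff:
  assumes f: "degree f h"
  shows "h = \<one> \<longleftrightarrow> (AE x in M. (x, f x) \<in> R)"
proof -
  have f': "h \<in> carrier Q" "AE x in M. (x, f x) \<in> U \<and> \<theta> (f x, x) = h"
    using f unfolding degree_def by auto
  have "AE x in M. (x, f x) \<in> R \<longleftrightarrow> h = \<one>"
    using f'(2) AE_U_kernel
  proof eventually_elim
    case (elim x)
    then have "(x, f x) \<in> R \<longleftrightarrow> \<theta> (x, f x) = \<one>" by blast
    also have "\<theta> (x, f x) = inv h" using elim(1) \<theta>_swap[of "f x" x] U.V_sym by auto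
    also have "inv h = \<one> \<longleftrightarrow> h = \<one>" using f'(1) by simp
    finally show ?case .
  qed
  from eventually_subst[OF this] show ?thesis by simp
qed

section \<open>The normalizer group and its quotient\<close>

lemma full_normalizer_degree:
  "full_normalizer M U R = {ae_class M f | f. \<exists>h. degree f h}"
proof (intro equalityI subsetI)
  fix A assume A: "A \<in> full_normalizer M U R"
  then have "A \<in> carrier (Aut M)" using full_group_carrier unfolding full_normalizer_eq by blast
  then obtain f where f: "f \<in> mp_maps M" "A = ae_class M f" unfolding Aut_carrier by auto
  then show "A \<in> {ae_class M f | f. \<exists>h. degree f h}"
    using A full_normalizer_iff[OF f(1)] degree_exists by blast
next
  fix A assume "A \<in> {ae_class M f | f. \<exists>h. degree f h}"
  then obtain f h where f: "A = ae_class M f" "degree f h" by auto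
  then have "f \<in> mp_maps M" "AE x in M. (x, f x) \<in> U" unfolding degree_def by auto
  then show "A \<in> full_normalizer M U R" using full_normalizer_iff degree_Aut_rel f by simp
qed

lemma full_normalizer_subgroup: "subgroup (full_normalizer M U R) (Aut M)"
proof (rule group.subgroupI[OF Aut_group])
  show "full_normalizer M U R \<subseteq> carrier (Aut M)"
    using full_group_carrier unfolding full_normalizer_eq by blast
  show "full_normalizer M U R \<noteq> {}"
    unfolding full_normalizer_degree using degree_onto[OF Q.one_closed] by blast
next
  fix A assume "A \<in> full_normalizer M U R"
  then obtain f h where f: "A = ae_class M f" "degree f h" unfolding full_normalizer_degree by auto
  then have "f \<in> mp_maps M" unfolding degree_def by blast
  then show "inv\<^bsub>Aut M\<^esub> A \<in> full_normalizer M U R"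
    using degree_minv[OF f(2)] unfolding f(1) full_normalizer_degree by (auto simp: Aut_inv)
next
  fix A B assume "A \<in> full_normalizer M U R" "B \<in> full_normalizer M U R"
  then obtain f h g k where fg: "A = ae_class M f" "degree f h" "B = ae_class M g" "degree g k"
    unfolding full_normalizer_degree by auto
  then have "f \<in> mp_maps M" "g \<in> mp_maps M" unfolding degree_def by auto
  then show "A \<otimes>\<^bsub>Aut M\<^esub> B \<in> full_normalizer M U R"
    using degree_comp[OF fg(2,4)] unfolding fg(1,3) full_normalizer_degree by (auto simp: Aut_mult)
qed

theorem quotient_iso: "Q \<cong> normalizer_quotient M U R"
proof -
  define N where "N = (Aut M)\<lparr>carrier := full_normalizer M U R\<rparr>"
  \<comment> \<open>All representatives of a class that have a degree have the same one by
    \<open>degree_unique\<close>, so the description is proper on the normalizer.\<close>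
  define \<Phi> where "\<Phi> A = (THE h. \<exists>f\<in>A. degree f h)" for A
  have \<Phi>: "\<Phi> (ae_class M f) = h" if f: "degree f h" for f h
    unfolding \<Phi>_def
  proof (rule the_equality)
    have "f \<in> mp_maps M" using f unfolding degree_def by blast
    then show "\<exists>g\<in>ae_class M f. degree g h" using f by (intro bexI[of _ f]) (auto simp: ae_eq_def)
    fix k assume "\<exists>g\<in>ae_class M f. degree g k"
    then obtain g where "AE x in M. f x = g x" "degree g k" by (auto simp: ae_eq_def)
    then show "k = h" using degree_unique[OF f] by blast
  qed
  interpret N: group N
    unfolding N_def by (rule group.subgroup_imp_group[OF Aut_group full_normalizer_subgroup])
  have N_carrier: "carrier N = {ae_class M f | f. \<exists>h. degree f h}"
    unfolding N_def by (simp add: full_normalizer_degree)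
  interpret \<Phi>: group_hom N Q \<Phi>
  proof
    show "\<Phi> \<in> hom N Q"
    proof (rule homI)
      fix A assume "A \<in> carrier N"
      then show "\<Phi> A \<in> carrier Q" unfolding N_carrier using \<Phi> by (auto simp: degree_def)
    next
      fix A B assume "A \<in> carrier N" "B \<in> carrier N"
      then obtain f h g k where fg: "A = ae_class M f" "degree f h" "B = ae_class M g" "degree g k"
        unfolding N_carrier by auto
      then have "f \<in> mp_maps M" "g \<in> mp_maps M" unfolding degree_def by auto
      then have "A \<otimes>\<^bsub>N\<^esub> B = ae_class M (f \<circ> g)" unfolding N_def fg by (simp add: Aut_mult)
      then show "\<Phi> (A \<otimes>\<^bsub>N\<^esub> B) = \<Phi> A \<otimes> \<Phi> B"
        using \<Phi>[OF fg(2)] \<Phi>[OF fg(4)] \<Phi>[OF degree_comp[OF fg(2,4)]] fg(1,3) by simp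
    qed
  qed
  have onto: "\<Phi> ` carrier N = carrier Q"
  proof (intro equalityI subsetI)
    fix h assume "h \<in> carrier Q"
    then obtain f where f: "degree f h" using degree_onto by blast
    then show "h \<in> \<Phi> ` carrier N" unfolding N_carrier using \<Phi>[OF f] by (intro image_eqI[of _ _ "ae_class M f"]) auto
  qed auto
  have ker: "kernel N Q \<Phi> = full_group M R"
  proof (intro equalityI subsetI)
    fix A assume "A \<in> kernel N Q \<Phi>"
    then obtain f h where f: "A = ae_class M f" "degree f h" "\<Phi> A = \<one>"
      unfolding kernel_def N_carrier by auto
    then have "f \<in> mp_maps M" "AE x in M. (x, f x) \<in> R"
      using \<Phi>[OF f(2)] degree_one_iff[OF f(2)] unfolding degree_def by auto
    then show "A \<in> full_group M R" using R.full_group_iff f(1) by simp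
  next
    fix A assume A: "A \<in> full_group M R"
    then obtain f where f: "f \<in> mp_maps M" "A = ae_class M f"
      using full_group_carrier unfolding Aut_carrier by blast
    have fR: "AE x in M. (x, f x) \<in> R" using A R.full_group_iff f by simp
    \<comment> \<open>\<open>R\<close> lies in \<open>U\<close> only up to null sets, which is
      enough to place \<open>[R]\<close> inside the normalizer.\<close>
    with AE_R_U have "AE x in M. (x, f x) \<in> U" by eventually_elim blast
    moreover have "ae_class M f \<in> Aut_rel M R" using A f(2) unfolding full_group_def by blast
    ultimately obtain h where h: "degree f h" using degree_exists[OF f(1)] by blast
    then have "\<Phi> A = \<one>" using \<Phi>[OF h] degree_one_iff[OF h] fR f(2) by simp
    then show "A \<in> kernel N Q \<Phi>" unfolding kernel_def N_carrier using f(2) h by auto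
  qed
  have "N Mod kernel N Q \<Phi> \<cong> Q"
    using \<Phi>.FactGroup_iso[OF onto] unfolding is_iso_def by blast
  moreover have "group (N Mod kernel N Q \<Phi>)"
    by (rule normal.factorgroup_is_group[OF \<Phi>.normal_kernel])
  ultimately have "Q \<cong> N Mod kernel N Q \<Phi>" by (metis group.iso_sym)
  then show ?thesis unfolding ker unfolding normalizer_quotient_def N_def .
qed

end

context ergodic_pair
begin

text \<open>All models of the quotient are isomorphic to one and the same group, so this also gives
  uniqueness of the quotient up to isomorphism.\<close>

theorem is_quotient_iso:
  assumes "is_quotient M U R Q"
  shows "Q \<cong> normalizer_quotient M U R"
proof -
  obtain \<theta> where "\<theta> \<in> restrict_space (M \<Otimes>\<^sub>M M) U \<rightarrow>\<^sub>M count_space (carrier Q)"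
    "\<forall>x y z. (x, y) \<in> U \<longrightarrow> (y, z) \<in> U \<longrightarrow> \<theta> (x, y) \<otimes>\<^bsub>Q\<^esub> \<theta> (y, z) = \<theta> (x, z)"
    "rel_ae_eq M R {p \<in> U. \<theta> p = \<one>\<^bsub>Q\<^esub>}"
    "AE x in M. \<forall>h\<in>carrier Q. \<exists>y. (y, x) \<in> U \<and> \<theta> (y, x) = h"
    and "group Q" "countable (carrier Q)"
    using assms unfolding is_quotient_def by blast
  then interpret quotient_cocycle M R U Q \<theta>
    by (intro quotient_cocycle.intro quotient_cocycle_axioms.intro ergodic_pair_axioms) auto
  show ?thesis by (rule quotient_iso)
qed

end

section \<open>The quotient group of a groupoid kernel\<close>

text \<open>Cancellation of \<open>g\<close>. It is applied to \<open>c (x, x)\<close>, which is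
  idempotent because the pair \<open>(x, x)\<close> is.\<close>

lemma (in discrete_borel_groupoid) idempotent_src:
  assumes "(g, g) \<in> composable G" "gmul G g g = g"
  shows "src G g = g"
proof -
  have g: "g \<in> space (arrows G)" "src G g = tgt G g" using assms(1) unfolding composable_def by auto
  have i: "ginv G g \<in> space (arrows G)" using measurable_space[OF inv_borel g(1)] .
  have "(ginv G g, g) \<in> composable G" using g(1) i src_inv unfolding composable_def by auto
  then have "gmul G (gmul G (ginv G g) g) g = gmul G (ginv G g) (gmul G g g)"
    using assms(1) by (rule mul_assoc)
  then have "gmul G (src G g) g = src G g" using inv_mul[OF g(1)] assms(2) by simp
  then show ?thesis using tgt_mul_id[OF g(1)] g(2) by simp
qed

locale groupoid_kernel = ergodic_pair M R U + G: discrete_borel_groupoid G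
  for M :: "'a measure" and R U and G :: "'g groupoid" +
  fixes X and c :: "'a \<times> 'a \<Rightarrow> 'g"
  assumes X: "X \<in> conull_sets M"
    and c_hom: "borel_groupoid_hom M (U \<inter> X \<times> X) G c"
    and c_kernel: "R \<inter> X \<times> X = {p \<in> U \<inter> X \<times> X. c p \<in> units G}"
begin

lemma X_sets [measurable]: "X \<in> sets M" and X_space: "x \<in> X \<Longrightarrow> x \<in> space M"
  using conull_setsD[OF X] by auto

lemma c_measurable: "c \<in> restrict_space (M \<Otimes>\<^sub>M M) (U \<inter> X \<times> X) \<rightarrow>\<^sub>M arrows G"
  using c_hom unfolding borel_groupoid_hom_def by blast

lemma c_mult:
  assumes "(x, y) \<in> U" "(y, z) \<in> U" "x \<in> X" "y \<in> X" "z \<in> X"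
  shows "(c (x, y), c (y, z)) \<in> composable G" "gmul G (c (x, y)) (c (y, z)) = c (x, z)"
  using c_hom assms unfolding borel_groupoid_hom_def by blast+

lemma c_preimage:
  assumes "C \<in> sets (arrows G)"
  shows "{p \<in> U \<inter> X \<times> X. c p \<in> C} \<in> sets (M \<Otimes>\<^sub>M M)"
proof -
  have W: "U \<inter> X \<times> X \<in> sets (M \<Otimes>\<^sub>M M)" using U.V_sets by auto
  then have sp: "space (restrict_space (M \<Otimes>\<^sub>M M) (U \<inter> X \<times> X)) = U \<inter> X \<times> X"
    using sets.sets_into_space[OF W] by (auto simp: space_restrict_space)
  have "c -` C \<inter> (U \<inter> X \<times> X) \<in> sets (restrict_space (M \<Otimes>\<^sub>M M) (U \<inter> X \<times> X))"
    using measurable_sets[OF c_measurable assms] unfolding sp .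
  then have "c -` C \<inter> (U \<inter> X \<times> X) \<in> sets (M \<Otimes>\<^sub>M M)"
    using W by (subst (asm) sets_restrict_space_iff) (auto intro: sets.Int)
  also have "c -` C \<inter> (U \<inter> X \<times> X) = {p \<in> U \<inter> X \<times> X. c p \<in> C}" by auto
  finally show ?thesis .
qed

text \<open>The object of the groupoid assigned to \<open>x\<close>: \<open>c (x, y)\<close> is an
  arrow from \<open>unit_at y\<close> to \<open>unit_at x\<close>.\<close>

definition unit_at :: "'a \<Rightarrow> 'g" where
  "unit_at x = c (x, x)"

lemma unit_at_unit:
  assumes x: "x \<in> X"
  shows "unit_at x \<in> space (arrows G)" "src G (unit_at x) = unit_at x" "tgt G (unit_at x) = unit_at x"
proof -
  have xx: "(x, x) \<in> U" using U.V_refl X_space x by blast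
  note * = c_mult[OF xx xx x x x, folded unit_at_def]
  show sp: "unit_at x \<in> space (arrows G)" using *(1) unfolding composable_def by auto
  show src: "src G (unit_at x) = unit_at x" by (rule G.idempotent_src[OF *])
  show "tgt G (unit_at x) = unit_at x" using G.tgt_src[OF sp] src by simp
qed

lemma c_src_tgt:
  assumes "(x, y) \<in> U" "x \<in> X" "y \<in> X"
  shows "c (x, y) \<in> space (arrows G)" "src G (c (x, y)) = unit_at y" "tgt G (c (x, y)) = unit_at x"
proof -
  have xx: "(x, x) \<in> U" and yy: "(y, y) \<in> U" using U.V_refl X_space assms by blast+
  have *: "(c (x, y), unit_at y) \<in> composable G" "(unit_at x, c (x, y)) \<in> composable G"
    unfolding unit_at_def using c_mult(1) assms xx yy by blast+
  then show "c (x, y) \<in> space (arrows G)" unfolding composable_def by auto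
  show "src G (c (x, y)) = unit_at y"
    using *(1) unit_at_unit(3)[OF assms(3)] unfolding composable_def by auto
  show "tgt G (c (x, y)) = unit_at x"
    using *(2) unit_at_unit(2)[OF assms(2)] unfolding composable_def by auto
qed

text \<open>A unit equals its own source and target, so pairs in the kernel join points over the
  same object. This makes \<open>unit_at\<close> invariant under \<open>R\<close> within
  \<open>X\<close>.\<close>

lemma R_c:
  assumes "(x, y) \<in> R" "x \<in> X" "y \<in> X"
  shows "(x, y) \<in> U" "c (x, y) = unit_at x" "unit_at x = unit_at y"
proof -
  have "(x, y) \<in> {p \<in> U \<inter> X \<times> X. c p \<in> units G}" using assms c_kernel by blast
  then show U: "(x, y) \<in> U" and "c (x, y) = unit_at x" "unit_at x = unit_at y"
    using c_src_tgt[of x y] assms G.tgt_src[of "c (x, y)"] unfolding units_def by auto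
qed

lemma AE_X_saturated: "AE x in M. x \<in> X \<and> (\<forall>y. (x, y) \<in> R \<longrightarrow> y \<in> X)"
  using conull_set_AE[OF X] R.AE_saturate[OF conull_set_AE[OF X]] by eventually_elim auto

text \<open>Each set of a countable separating family contains the value of the invariant map almost
  surely or almost never, and points with the same answers coincide.\<close>

lemma AE_unit_at_const:
  obtains u where "u \<in> units G" "AE x in M. x \<in> X \<and> unit_at x = u"
proof -
  obtain B where B: "countable B" "B \<subseteq> sets (arrows G)"
    "\<And>g h. g \<in> space (arrows G) \<Longrightarrow> h \<in> space (arrows G) \<Longrightarrow> g \<noteq> h \<Longrightarrow> \<exists>V\<in>B. g \<in> V \<and> h \<notin> V"
    by (rule standard_borel_separating[OF G.standard]) (rule that)
  define E where "E V = {x \<in> X. unit_at x \<in> V}" for V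
  have zero_one: "(AE x in M. x \<in> E V) \<or> (AE x in M. x \<notin> E V)" if V: "V \<in> B" for V
  proof (rule R.AE_zero_one)
    have [measurable]: "{p \<in> U \<inter> X \<times> X. c p \<in> V} \<in> sets (M \<Otimes>\<^sub>M M)"
      using V B(2) by (intro c_preimage) auto
    have "E V = {x \<in> space M. (x, x) \<in> {p \<in> U \<inter> X \<times> X. c p \<in> V}}"
      unfolding E_def unit_at_def using X_space U.V_refl by auto
    also have "\<dots> \<in> sets M" by measurable
    finally show "E V \<in> sets M" .
    show "AE x in M. \<forall>y. (x, y) \<in> R \<longrightarrow> x \<in> E V \<longrightarrow> y \<in> E V"
      using AE_X_saturated
    proof eventually_elim
      case (elim x)
      then show ?case using R_c(3)[of x] unfolding E_def by auto
    qed
  qed auto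
  \<comment> \<open>The inner statement is a truth value independent of the outer point: the almost
    sure answer for \<open>V\<close>.\<close>
  have "AE x in M. x \<in> E V \<longleftrightarrow> (AE x in M. x \<in> E V)" if "V \<in> B" for V
    using zero_one[OF that]
  proof
    assume "AE x in M. x \<notin> E V"
    moreover from this have "\<not> (AE x in M. x \<in> E V)"
    proof (rule contrapos_pn)
      assume "AE x in M. x \<in> E V"
      with \<open>AE x in M. x \<notin> E V\<close> have "AE x in M. False" by eventually_elim simp
      then show "\<not> (AE x in M. x \<notin> E V)" by simp
    qed
    ultimately show ?thesis by simp
  qed simp
  then have "AE x in M. \<forall>V\<in>B. x \<in> E V \<longleftrightarrow> (AE x in M. x \<in> E V)"
    using B(1) by (simp add: AE_ball_countable)
  with conull_set_AE[OF X] have "AE x in M. x \<in> X \<and> (\<forall>V\<in>B. unit_at x \<in> V \<longleftrightarrow> (AE x in M. x \<in> E V))"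
    by eventually_elim (auto simp: E_def)
  then obtain Y where Y: "Y \<in> conull_sets M"
    "\<And>x. x \<in> Y \<Longrightarrow> x \<in> X \<and> (\<forall>V\<in>B. unit_at x \<in> V \<longleftrightarrow> (AE x in M. x \<in> E V))"
    by (rule AE_conull_set) (rule that)
  have "Y \<noteq> {}"
  proof
    assume "Y = {}"
    then have "AE x in M. False" using conull_set_AE[OF Y(1)] by simp
    then show False by simp
  qed
  then obtain x0 where x0: "x0 \<in> Y" by blast
  have const: "unit_at x = unit_at x0" if "x \<in> Y" for x
  proof (rule ccontr)
    assume "unit_at x \<noteq> unit_at x0"
    moreover have "x \<in> X" "x0 \<in> X" using Y(2) that x0 by auto
    ultimately obtain V where "V \<in> B" "unit_at x \<in> V" "unit_at x0 \<notin> V"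
      using B(3) unit_at_unit(1) by blast
    then show False using Y(2)[OF that] Y(2)[OF x0] by blast
  qed
  have "AE x in M. x \<in> X \<and> unit_at x = unit_at x0"
    using conull_set_AE[OF Y(1)] by eventually_elim (use Y(2) const in blast)
  moreover have "unit_at x0 \<in> units G" using unit_at_unit Y(2) x0 unfolding units_def by blast
  ultimately show thesis by (intro that)
qed

text \<open>For \<open>(x, y)\<close> in \<open>R\<close>, multiplying by \<open>c (x, y)\<close> is
  multiplying by a unit, so a value attained over \<open>x\<close> is also attained over
  \<open>y\<close>. The set is a projection, hence measurable up to null sets only.\<close>

lemma AE_range_zero_one:
  assumes g: "g \<in> space (arrows G)"
  defines "E \<equiv> {x \<in> X. \<exists>y\<in>X. (y, x) \<in> U \<and> c (y, x) = g}"
  shows "(AE x in M. x \<in> E) \<or> (AE x in M. x \<notin> E)"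
proof -
  define S where "S = {p \<in> space (M \<Otimes>\<^sub>M M). (snd p, fst p) \<in> {p \<in> U \<inter> X \<times> X. c p \<in> {g}}}"
  have [measurable]: "{p \<in> U \<inter> X \<times> X. c p \<in> {g}} \<in> sets (M \<Otimes>\<^sub>M M)"
    by (rule c_preimage[OF standard_borel_singleton[OF G.standard g]])
  have S: "S \<in> sets (M \<Otimes>\<^sub>M M)" unfolding S_def by measurable
  have "Domain S = E"
  proof (intro equalityI subsetI)
    fix x assume "x \<in> E"
    then obtain y where "x \<in> X" "y \<in> X" "(y, x) \<in> U" "c (y, x) = g" unfolding E_def by auto
    then have "(x, y) \<in> S" unfolding S_def using X_space by (simp add: space_pair_measure)
    then show "x \<in> Domain S" by blast
  qed (auto simp: S_def E_def)
  then obtain A where A: "A \<in> sets M" "AE x in M. x \<in> E \<longleftrightarrow> x \<in> A"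
    using R.Domain_AE_measurable[OF S] by auto
  show ?thesis
  proof (rule R.AE_zero_one[OF A])
    show "AE x in M. \<forall>y. (x, y) \<in> R \<longrightarrow> x \<in> E \<longrightarrow> y \<in> E"
      using AE_X_saturated
    proof eventually_elim
      case (elim x)
      show ?case
      proof (intro allI impI)
        fix y assume xy: "(x, y) \<in> R" and "x \<in> E"
        then obtain z where z: "z \<in> X" "(z, x) \<in> U" "c (z, x) = g" unfolding E_def by auto
        have x: "x \<in> X" and y: "y \<in> X" using elim xy by auto
        note * = R_c[OF xy x y]
        have "c (z, y) = gmul G (c (z, x)) (c (x, y))"
          using c_mult(2)[OF z(2) *(1) z(1) x y] by simp
        also have "c (x, y) = src G (c (z, x))" using *(2) c_src_tgt(2)[OF z(2,1) x] by simp
        also have "gmul G (c (z, x)) \<dots> = c (z, x)" by (rule G.mul_src[OF c_src_tgt(1)[OF z(2,1) x]])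
        finally show "y \<in> E" using z y U.V_trans[OF z(2) *(1)] unfolding E_def by auto
      qed
    qed
  qed
qed

text \<open>On an invariant conull set the cocycle takes values in a countable isotropy group, and each
  value is attained either almost everywhere or almost nowhere; the former values form the
  quotient group.\<close>

theorem quotient_exists: "\<exists>Q :: nat monoid. is_quotient M U R Q"
proof -
  obtain u where u: "u \<in> units G" "AE x in M. x \<in> X \<and> unit_at x = u"
    by (rule AE_unit_at_const) (rule that)
  define \<Gamma> where "\<Gamma> = {g \<in> space (arrows G). src G g = u}"
  have \<Gamma>: "countable \<Gamma>" unfolding \<Gamma>_def by (rule G.countable_fibers[OF u(1)])
  define E where "E g = {x \<in> X. \<exists>y\<in>X. (y, x) \<in> U \<and> c (y, x) = g}" for g
  \<comment> \<open>By the zero-one dichotomy for the countably many arrows with source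
    \<open>u\<close>, the values attained over almost every point are exactly the elements of
    \<open>K\<close>.\<close>
  define K where "K = {g \<in> \<Gamma>. AE x in M. x \<in> E g}"
  have "AE x in M. x \<in> E g \<longleftrightarrow> g \<in> K" if g: "g \<in> \<Gamma>" for g
  proof -
    have "(AE x in M. x \<in> E g) \<or> (AE x in M. x \<notin> E g)"
      unfolding E_def using g by (intro AE_range_zero_one) (simp add: \<Gamma>_def)
    then show ?thesis
    proof
      assume nE: "AE x in M. x \<notin> E g"
      have "g \<notin> K"
      proof
        assume "g \<in> K"
        then have "AE x in M. x \<in> E g" unfolding K_def by simp
        with nE have "AE x in M. False" by eventually_elim simp
        then show False by simp
      qed
      then show ?thesis using nE by simp
    qed (use g in \<open>simp add: K_def\<close>)
  qed
  then have "AE x in M. \<forall>g\<in>\<Gamma>. x \<in> E g \<longleftrightarrow> g \<in> K" using \<Gamma> by (simp add: AE_ball_countable)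
  with u(2) have "AE x in M. x \<in> X \<and> unit_at x = u \<and> (\<forall>g\<in>\<Gamma>. x \<in> E g \<longleftrightarrow> g \<in> K)"
    by eventually_elim auto
  then obtain Y where Y: "Y \<in> conull_sets M"
    "\<And>x. x \<in> Y \<Longrightarrow> x \<in> X \<and> unit_at x = u \<and> (\<forall>g\<in>\<Gamma>. x \<in> E g \<longleftrightarrow> g \<in> K)"
    and Y_inv: "\<And>x y. x \<in> Y \<Longrightarrow> (x, y) \<in> U \<Longrightarrow> y \<in> Y"
    by (rule U.AE_invariant_conull) (rule that)
  have YX: "x \<in> X" and Y_unit: "unit_at x = u" if "x \<in> Y" for x using Y(2)[OF that] by auto
  have Y_sets [measurable]: "Y \<in> sets M" and Y_space: "\<And>x. x \<in> Y \<Longrightarrow> x \<in> space M"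
    using conull_setsD Y(1) by auto
  have c_\<Gamma>: "c (y, x) \<in> \<Gamma>" if "y \<in> Y" "x \<in> Y" "(y, x) \<in> U" for x y
    using c_src_tgt[OF that(3) YX YX] Y_unit that unfolding \<Gamma>_def by auto
  have c_K: "c (y, x) \<in> K" if "y \<in> Y" "x \<in> Y" "(y, x) \<in> U" for x y
  proof -
    have "x \<in> E (c (y, x))" using that YX unfolding E_def by auto
    then show ?thesis using Y(2)[OF that(2)] c_\<Gamma>[OF that] by blast
  qed
  have K_c: "\<exists>y\<in>Y. (y, x) \<in> U \<and> c (y, x) = g" if "g \<in> K" "x \<in> Y" for g x
  proof -
    have "x \<in> E g" using Y(2)[OF that(2)] that(1) unfolding K_def by blast
    then obtain y where "(y, x) \<in> U" "c (y, x) = g" unfolding E_def by auto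
    then show ?thesis using Y_inv[OF that(2)] U.V_sym by blast
  qed
  have "Y \<noteq> {}"
  proof
    assume "Y = {}"
    then have "AE x in M. False" using conull_set_AE[OF Y(1)] by simp
    then show False by simp
  qed
  then obtain x0 where x0: "x0 \<in> Y" by blast
  have K_countable: "countable K" using \<Gamma> unfolding K_def by (rule countable_subset[rotated]) auto
  have u_c: "c (x, x) = u" if "x \<in> Y" for x using Y_unit[OF that] unfolding unit_at_def .
  have u_K: "u \<in> K" using c_K[OF x0 x0 U.V_refl[OF Y_space[OF x0]]] u_c[OF x0] by simp
  have c_mult_Y: "gmul G (c (x, y)) (c (y, z)) = c (x, z)"
    if "(x, y) \<in> U" "(y, z) \<in> U" "x \<in> Y" "y \<in> Y" "z \<in> Y" for x y z
    using c_mult(2)[OF that(1,2) YX YX YX] that by blast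
  \<comment> \<open>Over the base point, \<open>h\<close> is realized by a pair
    \<open>(y, x0)\<close> and \<open>g\<close> by a pair \<open>(z, y)\<close> that composes with
    it. The product is then the value at \<open>(z, x0)\<close>, which keeps \<open>K\<close>
    closed.\<close>
  have K_repr: "\<exists>y\<in>Y. \<exists>z\<in>Y. (y, x0) \<in> U \<and> (z, y) \<in> U \<and> c (y, x0) = h \<and> c (z, y) = g"
    if "g \<in> K" "h \<in> K" for g h
    using K_c[OF that(2) x0] K_c[OF that(1)] by blast
  have K_mult: "gmul G g h \<in> K" if gh: "g \<in> K" "h \<in> K" for g h
  proof -
    obtain y z where yz: "y \<in> Y" "z \<in> Y" "(y, x0) \<in> U" "(z, y) \<in> U" "c (y, x0) = h" "c (z, y) = g"
      using K_repr[OF gh] by blast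
    then have "gmul G g h = c (z, x0)" using c_mult_Y[OF yz(4,3,2,1) x0] by simp
    then show ?thesis using c_K[OF yz(2) x0] U.V_trans yz by auto
  qed
  have K_arrow: "g \<in> space (arrows G)" "src G g = u" "tgt G g = u" if g: "g \<in> K" for g
  proof -
    obtain y where y: "y \<in> Y" "(y, x0) \<in> U" "c (y, x0) = g" using K_c[OF g x0] by blast
    show "g \<in> space (arrows G)" "src G g = u" "tgt G g = u"
      using c_src_tgt[OF y(2) YX[OF y(1)] YX[OF x0]] Y_unit[OF x0] Y_unit[OF y(1)] y(3) by auto
  qed
  have K_assoc: "gmul G (gmul G g h) k = gmul G g (gmul G h k)" if "g \<in> K" "h \<in> K" "k \<in> K" for g h k
  proof (rule G.mul_assoc)
    show "(g, h) \<in> composable G" "(h, k) \<in> composable G"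
      using K_arrow that unfolding composable_def by auto
  qed
  have K_one: "gmul G u g = g" if g: "g \<in> K" for g
  proof -
    obtain y where y: "y \<in> Y" "(y, x0) \<in> U" "c (y, x0) = g" using K_c[OF g x0] by blast
    then show ?thesis using c_mult_Y[OF U.V_refl[OF Y_space[OF y(1)]] y(2) y(1) y(1) x0] u_c by simp
  qed
  have K_inv: "\<exists>h\<in>K. gmul G h g = u" if g: "g \<in> K" for g
  proof -
    obtain y where y: "y \<in> Y" "(y, x0) \<in> U" "c (y, x0) = g" using K_c[OF g x0] by blast
    have "(x0, y) \<in> U" using U.V_sym y(2) .
    then have "gmul G (c (x0, y)) g = u" using c_mult_Y[OF _ y(2) x0 y(1) x0] y(3) u_c[OF x0] by simp
    then show ?thesis using c_K[OF x0 y(1) \<open>(x0, y) \<in> U\<close>] by blast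
  qed
  \<comment> \<open>\<open>K\<close> lives in the type of arrows; numbering its elements moves the
    group to the natural numbers, a fixed type for the existence claim.\<close>
  define e where "e = to_nat_on K"
  define d where "d = inv_into K e"
  have e: "inj_on e K" unfolding e_def by (rule inj_on_to_nat_on[OF K_countable])
  have de [simp]: "d (e g) = g" if "g \<in> K" for g unfolding d_def by (rule inv_into_f_f[OF e that])
  define Q where "Q = \<lparr>carrier = e ` K, mult = (\<lambda>a b. e (gmul G (d a) (d b))), one = e u\<rparr>"
  have Q_simps: "carrier Q = e ` K" "a \<otimes>\<^bsub>Q\<^esub> b = e (gmul G (d a) (d b))" "\<one>\<^bsub>Q\<^esub> = e u" for a b
    unfolding Q_def by auto
  have group: "group Q"
  proof (rule groupI)
    fix a assume "a \<in> carrier Q"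
    then obtain g where g: "g \<in> K" "a = e g" unfolding Q_simps by auto
    then show "\<one>\<^bsub>Q\<^esub> \<otimes>\<^bsub>Q\<^esub> a = a" unfolding Q_simps using u_K K_one by simp
    obtain h where h: "h \<in> K" "gmul G h g = u" using K_inv[OF g(1)] by blast
    then show "\<exists>b\<in>carrier Q. b \<otimes>\<^bsub>Q\<^esub> a = \<one>\<^bsub>Q\<^esub>" unfolding Q_simps using g by (intro bexI[of _ "e h"]) auto
  qed (auto simp: Q_simps K_mult K_assoc u_K)
  \<comment> \<open>The cocycle is controlled only on \<open>Y\<close>, so the unit is the default
    elsewhere. Since \<open>Y\<close> is a union of classes of \<open>U\<close>, no product mixes
    the two cases.\<close>
  define \<theta> where "\<theta> p = (if p \<in> Y \<times> Y then e (c p) else e u)" for p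
  have \<theta>_K: "\<theta> p \<in> e ` K" if "p \<in> U" for p
    using that c_K u_K unfolding \<theta>_def by (cases p) auto
  have sp: "space (restrict_space (M \<Otimes>\<^sub>M M) U) = U"
    using sets.sets_into_space[OF U.V_sets] by (auto simp: space_restrict_space)
  have "\<theta> \<in> restrict_space (M \<Otimes>\<^sub>M M) U \<rightarrow>\<^sub>M count_space (carrier Q)"
  proof (subst measurable_count_space_eq_countable)
    show "countable (carrier Q)" unfolding Q_simps using K_countable by simp
    have "\<theta> -` {e g} \<inter> U \<in> sets (restrict_space (M \<Otimes>\<^sub>M M) U)" if g: "g \<in> K" for g
    proof -
      \<comment> \<open>Because of the default value, the fiber over the unit also collects the
        pairs outside \<open>Y \<times> Y\<close>.\<close>
      have "\<theta> -` {e g} \<inter> U = {p \<in> U \<inter> X \<times> X. c p \<in> {g}} \<inter> Y \<times> Y \<union> (if g = u then U - Y \<times> Y else {})"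
        using c_K YX e g u_K unfolding \<theta>_def by (auto simp: inj_on_eq_iff split: if_splits)
      also have "\<dots> \<in> sets (M \<Otimes>\<^sub>M M)"
      proof -
        have "g \<in> space (arrows G)" using g unfolding K_def \<Gamma>_def by simp
        then have "{p \<in> U \<inter> X \<times> X. c p \<in> {g}} \<in> sets (M \<Otimes>\<^sub>M M)"
          by (intro c_preimage standard_borel_singleton[OF G.standard])
        moreover have "Y \<times> Y \<in> sets (M \<Otimes>\<^sub>M M)" by auto
        ultimately show ?thesis using U.V_sets by (auto intro: sets.Un sets.Int sets.Diff)
      qed
      finally show ?thesis using U.V_sets by (subst sets_restrict_space_iff) (auto intro: sets.Int)
    qed
    then show "\<theta> \<in> space (restrict_space (M \<Otimes>\<^sub>M M) U) \<rightarrow> carrier Q \<and>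
        (\<forall>a\<in>carrier Q. \<theta> -` {a} \<inter> space (restrict_space (M \<Otimes>\<^sub>M M) U) \<in> sets (restrict_space (M \<Otimes>\<^sub>M M) U))"
      unfolding sp Q_simps using \<theta>_K by auto
  qed
  moreover have "\<theta> (x, y) \<otimes>\<^bsub>Q\<^esub> \<theta> (y, z) = \<theta> (x, z)" if xyz: "(x, y) \<in> U" "(y, z) \<in> U" for x y z
  proof (cases "y \<in> Y")
    case True
    then have x: "x \<in> Y" and z: "z \<in> Y" using xyz Y_inv U.V_sym by blast+
    show ?thesis unfolding Q_simps \<theta>_def using True x z c_K xyz c_mult_Y by simp
  next
    case False
    then have "x \<notin> Y" "z \<notin> Y" using xyz Y_inv U.V_sym by blast+
    then show ?thesis unfolding Q_simps \<theta>_def using False u_K K_one by simp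
  qed
  moreover have "rel_ae_eq M R {p \<in> U. \<theta> p = \<one>\<^bsub>Q\<^esub>}"
  proof -
    have "(x, y) \<in> R \<longleftrightarrow> (x, y) \<in> U \<and> \<theta> (x, y) = e u" if xy: "x \<in> Y" "y \<in> Y" for x y
    proof -
      have "(x, y) \<in> R \<longleftrightarrow> (x, y) \<in> R \<inter> X \<times> X" using YX xy by simp
      also have "\<dots> \<longleftrightarrow> (x, y) \<in> U \<and> c (x, y) \<in> units G" unfolding c_kernel using YX xy by simp
      also have "\<dots> \<longleftrightarrow> (x, y) \<in> U \<and> c (x, y) = u"
        using c_\<Gamma>[OF xy] u(1) unfolding units_def \<Gamma>_def by auto
      also have "\<dots> \<longleftrightarrow> (x, y) \<in> U \<and> \<theta> (x, y) = e u"
        unfolding \<theta>_def using xy c_K[OF xy] u_K e by (auto simp: inj_on_eq_iff)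
      finally show ?thesis .
    qed
    then have "R \<inter> Y \<times> Y = {p \<in> U. \<theta> p = \<one>\<^bsub>Q\<^esub>} \<inter> Y \<times> Y" unfolding Q_simps by auto
    then show ?thesis unfolding rel_ae_eq_def using Y(1) by blast
  qed
  moreover have "AE x in M. \<forall>h\<in>carrier Q. \<exists>y. (y, x) \<in> U \<and> \<theta> (y, x) = h"
    using conull_set_AE[OF Y(1)]
  proof eventually_elim
    case (elim x)
    show ?case
    proof
      fix h assume "h \<in> carrier Q"
      then obtain g where g: "g \<in> K" "h = e g" unfolding Q_simps by auto
      obtain y where "y \<in> Y" "(y, x) \<in> U" "c (y, x) = g" using K_c[OF g(1) elim] by blast
      then show "\<exists>y. (y, x) \<in> U \<and> \<theta> (y, x) = h" unfolding \<theta>_def using elim g(2) by auto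
    qed
  qed
  moreover have "countable (carrier Q)" unfolding Q_simps using K_countable by simp
  ultimately have "is_quotient M U R Q" using group unfolding is_quotient_def by blast
  then show ?thesis by blast
qed

end

text \<open>A carrier in the natural numbers suffices for existence, as the quotient is countable;
  the second clause covers models on an arbitrary type.\<close>

theorem corollary3p4:
  fixes M :: "'a measure" and R U :: "('a \<times> 'a) set"
  assumes "standard_borel_prob_space M"
    and "ergodic_discrete_pmp M R"
    and "ergodic_discrete_pmp M U"
    and "rel_ae_le M R U"
    and "normal_subrel TYPE('g) M R U"
  shows "(\<exists>Q :: nat monoid. is_quotient M U R Q \<and> Q \<cong> normalizer_quotient M U R)
    \<and> (\<forall>Q :: 'q monoid. is_quotient M U R Q \<longrightarrow> Q \<cong> normalizer_quotient M U R)
    \<and> full_normalizer M U R = full_group M U \<inter> Aut_rel M R"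
proof -
  have "prob_space M" "standard_borel M"
    using assms(1) unfolding standard_borel_prob_space_def by auto
  then have "standard_prob_space M"
    by (simp add: standard_prob_space_def standard_prob_space_axioms_def)
  then interpret ergodic_pair M R U
    using assms(2-4) unfolding ergodic_discrete_pmp_def
    by (simp add: ergodic_pair_def ergodic_pair_axioms_def ergodic_relation_def
        ergodic_relation_axioms_def pmp_relation_def pmp_relation_axioms_def)
  obtain X c and G :: "'g groupoid" where "X \<in> conull_sets M" "discrete_borel_groupoid G"
    "borel_groupoid_hom M (U \<inter> X \<times> X) G c" "R \<inter> X \<times> X = {p \<in> U \<inter> X \<times> X. c p \<in> units G}"
    using assms(5) unfolding normal_subrel_def by blast
  then interpret groupoid_kernel M R U G X c
    by (simp add: groupoid_kernel_def groupoid_kernel_axioms_def ergodic_pair_axioms)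
  obtain Q :: "nat monoid" where "is_quotient M U R Q"
    using quotient_exists by (rule exE)
  then show ?thesis
    by (intro conjI allI impI exI[of _ Q] is_quotient_iso full_normalizer_eq)
qed

end
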